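(* Let $c$ be a well-formed RGA term, open or closed. Then: (1) $\emptyset\vdash c$ is derivable if and only if $c\Downarrow_s\mathsf{tt}$ for some $s\in\mathbb N$; (2) for every $r\in\mathbb N$, $\emptyset\vdash c=\underline r$ is derivable if and only if $c\Downarrow_s r$ for some $s\in\mathbb N$.
   Context: **Terms.** Raw terms are: variables $v_i$ ($i\in\mathbb N$, de Bruijn indices), and operator nodes, each consisting of an operator code, a binder count $k\in\mathbb N$ and a finite list of raw terms as arguments, in each of which the $k$ lowest indices are bound. RGA has ten operators: constants $\bot$, $\mathbf 0$, $\mathcal R$ (recursor), $\mathcal A$ (universal quantifier combinator); unary $\mathbf S$, $\neg$; unary $\lambda$ (binder count 1, the only binder); binary $=$, $\lor$, and application $\cdot$ (left associative). A term $t$ is well-formed, $\mathrm{wf}(t)$, iff it is built from variables and these ten operators at these arities and binder counts. "Term" means raw term; formulas are just terms. Closed means having no free variables. $\underline n=\mathbf S^n\mathbf 0$ is the numeral of $n$. $[v_i\mapsto s]t$ (also $[i\mapsto s]t$): capture-avoiding replacement of the free variable $v_i$ by $s$, other free variables unchanged. $b[t]$: $\beta$-instance, replacing index $0$ in $b$ by $t$ and decrementing all other free indices. $\uparrow t$: all free indices increased by one; $\uparrow\Gamma$ elementwise. $\mathrm{fv}$: set of free variables. Abbreviations: $t\neq u:=\neg(t=u)$; $t\,\mathsf N:=(t=t)$; $t\,\mathsf B:=(t\lor\neg t)$; $t\land u:=\neg(\neg t\lor\neg u)$. **Head steps** $t\triangleright t'$ (syntactic relation): $(\lambda b)\cdot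 t\triangleright b[t]$ if $\mathrm{wf}(t)$; $\mathcal R\cdot g\cdot h\cdot\mathbf 0\triangleright g$ if $\mathrm{wf}(h)$; $\mathcal R\cdot g\cdot h\cdot(\mathbf S\,\underline n)\triangleright h\cdot\underline n\cdot(\mathcal R\cdot g\cdot h\cdot\underline n)$ if $\mathrm{wf}(g)$; and $t\cdot u\triangleright t'\cdot u$ if $t\triangleright t'$. **Proofs.** A judgment $\Gamma\vdash c$ has a finite set $\Gamma$ of terms and a term $c$. A proof is a finite list of judgments each following from earlier entries by one rule below; $P\rhd(\Gamma\vdash c)$ means $P$ is a valid proof containing $\Gamma\vdash c$; a judgment is derivable if some proof contains it. Writing $\Gamma\vdash c$ as an assertion means derivability. Rules ($\Rightarrow$ from premises to conclusion, $\Leftrightarrow$ both directions): Structural: $\mathrm{wf}(c)\Rightarrow\Gamma,c\vdash c$; $\Gamma\vdash c\Rightarrow\Gamma,a\vdash c$; $\Gamma\vdash a$ and $\Gamma,a\vdash c\Rightarrow\Gamma\vdash c$; $\Gamma\vdash c$ with $\Gamma,c,s$ well-formed $\Rightarrow[v\mapsto s]\Gamma\vdash[v\mapsto s]c$. Truth values: $\Gamma\vdash a\Leftrightarrow\Gamma\vdash a=\underline 1$; $\Gamma\vdash\neg a\Leftrightarrow\Gamma\vdash a=\underline 0$. Negation: $\Gamma\vdash\neg a$, $\Gamma\vdash a$, $\mathrm{wf}(c)\Rightarrow\Gamma\vdash c$; $\Gamma\vdash a\Leftrightarrow\Gamma\vdash\neg\neg a$. Disjunction: $\Gamma\vdash a$,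 $\mathrm{wf}(b)\Rightarrow\Gamma\vdash a\lor b$; $\Gamma\vdash b$, $\mathrm{wf}(a)\Rightarrow\Gamma\vdash a\lor b$; $\Gamma\vdash\neg a$, $\Gamma\vdash\neg b\Rightarrow\Gamma\vdash\neg(a\lor b)$; $\Gamma\vdash a\lor b$, $\Gamma,a\vdash c$, $\Gamma,b\vdash c\Rightarrow\Gamma\vdash c$; $\Gamma\vdash\neg(a\lor b)\Rightarrow\Gamma\vdash\neg a$, and $\Rightarrow\Gamma\vdash\neg b$. Equality: $\Gamma\vdash a\,\mathsf N\Leftrightarrow\Gamma\vdash a=a$; $\Gamma\vdash a=b\Rightarrow\Gamma\vdash b=a$; $\Gamma\vdash a=b$, $\Gamma\vdash[v\mapsto a]p$, $\mathrm{wf}(p)\Rightarrow\Gamma\vdash[v\mapsto b]p$; $\Gamma\vdash a\ne b\Rightarrow\Gamma\vdash b\ne a$; $\Gamma\vdash a\,\mathsf N$, $\Gamma\vdash b\,\mathsf N\Rightarrow\Gamma\vdash(a=b)\,\mathsf B$; $\Gamma\vdash(a=b)\,\mathsf B\Rightarrow\Gamma\vdash(a\,\mathsf N)\land(b\,\mathsf N)$. Naturals: $\Gamma\vdash\mathbf 0\,\mathsf N$; $\Gamma\vdash a\,\mathsf N\Leftrightarrow\Gamma\vdash\mathbf S a\,\mathsf N$; $\Gamma\vdash a\,\mathsf N\Rightarrow\Gamma\vdash\mathbf S a\ne\mathbf 0$; $\Gamma\vdash a\ne b\Leftrightarrow\Gamma\vdash\mathbf S a\ne\mathbf S b$; $\Gamma\vdash\mathbf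 S a=\mathbf S b\Rightarrow\Gamma\vdash a=b$; $\Gamma\vdash\bot\,\mathsf N$, $\mathrm{wf}(p)\Rightarrow\Gamma\vdash p$. Induction: $\Gamma\vdash[i\mapsto\mathbf 0]c$; $v_i\,\mathsf N,c,\Gamma\vdash[i\mapsto\mathbf S v_i]c$; $\Gamma\vdash a\,\mathsf N$; $\mathrm{wf}(c)$; $i\notin\mathrm{fv}(\Gamma)$ $\Rightarrow\Gamma\vdash[i\mapsto a]c$. Conversion: if $c\triangleright c'$: $\Gamma\vdash c'\Leftrightarrow\Gamma\vdash c$; $\Gamma\vdash c'\,\mathsf N\Rightarrow\Gamma\vdash c=c'$. Recursor: $\Gamma\vdash m\,\mathsf N$, $\Gamma\vdash(h\cdot m\cdot(\mathcal R\cdot g\cdot h\cdot m))\,\mathsf N$, $\mathrm{wf}(g)\Rightarrow\Gamma\vdash\mathcal R\cdot g\cdot h\cdot(\mathbf S m)=h\cdot m\cdot(\mathcal R\cdot g\cdot h\cdot m)$. Quantifier: $v_0\,\mathsf N,\uparrow\Gamma\vdash\uparrow f\cdot v_0\Rightarrow\Gamma\vdash\mathcal A\cdot f$; $\Gamma\vdash\mathcal A\cdot f$, $\Gamma\vdash a\,\mathsf N\Rightarrow\Gamma\vdash f\cdot a$; $\Gamma\vdash\neg(f\cdot a)$, $\Gamma\vdash a\,\mathsf N\Rightarrow\Gamma\vdash\neg(\mathcal A\cdot f)$; $\Gamma\vdash\neg(\mathcal A\cdot f)$ and $v_0\,\mathsf N,\neg(\uparrow f\cdot v_0),\uparrow\Gamma\vdash\uparrow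 c\Rightarrow\Gamma\vdash c$. **Evaluation.** Fix a standard effective injective Gödel coding $P\mapsto\ulcorner P\urcorner\in\mathbb N$ of proofs. Let $\mathsf{tt}=1$, $\mathsf{ff}=0$. Head shapes $w$ are: $\lambda b$; $\mathcal R$; $\mathcal R\,g$; $\mathcal R\,g\,h$; $\mathcal A$. Value evaluation $t\Downarrow_s r$ ($r,s\in\mathbb N$) and head evaluation $t\Downarrow^{\mathrm{hd}}_s w$ are the least relations on (possibly open) terms such that for all $s$ (there are no clauses for $\bot$ or variables): Values: $\mathbf 0\Downarrow_{s+1}0$; $a\Downarrow_s n\Rightarrow\mathbf S a\Downarrow_{s+1}n+1$; $a\Downarrow_s m$, $b\Downarrow_s n\Rightarrow(a=b)\Downarrow_{s+1}\mathsf{tt}$ if $m=n$ and $\mathsf{ff}$ otherwise; $a\Downarrow_s\mathsf{ff}\Rightarrow\neg a\Downarrow_{s+1}\mathsf{tt}$; $a\Downarrow_s\mathsf{tt}\Rightarrow\neg a\Downarrow_{s+1}\mathsf{ff}$; $a\Downarrow_s\mathsf{tt}$ or $b\Downarrow_s\mathsf{tt}\Rightarrow(a\lor b)\Downarrow_{s+1}\mathsf{tt}$; $a\Downarrow_s\mathsf{ff}$ and $b\Downarrow_s\mathsf{ff}\Rightarrow(a\lor b)\Downarrow_{s+1}\mathsf{ff}$; $t\Downarrow^{\mathrm{hd}}_s\lambda b$, $b[u]\Downarrow_s r\Rightarrow t\cdot u\Downarrow_{s+1}r$; $t\Downarrow^{\mathrm{hd}}_s\mathcal R\,g\,h$, $m\Downarrow_s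 0$, $g\Downarrow_s r\Rightarrow t\cdot m\Downarrow_{s+1}r$; $t\Downarrow^{\mathrm{hd}}_s\mathcal R\,g\,h$, $m\Downarrow_s k+1$, $h\cdot\underline k\cdot(\mathcal R\cdot g\cdot h\cdot\underline k)\Downarrow_s r\Rightarrow t\cdot m\Downarrow_{s+1}r$. Quantifier: if $t\Downarrow^{\mathrm{hd}}_s\mathcal A$ and $\ulcorner P\urcorner\le s$, then $P\rhd(\{v_0\,\mathsf N\}\vdash\uparrow u\cdot v_0)\Rightarrow t\cdot u\Downarrow_{s+1}\mathsf{tt}$, and $P\rhd(\emptyset\vdash\neg(u\cdot\underline i))$ for some $i\in\mathbb N$ $\Rightarrow t\cdot u\Downarrow_{s+1}\mathsf{ff}$. Heads: $\lambda b\Downarrow^{\mathrm{hd}}_{s+1}\lambda b$; $\mathcal R\Downarrow^{\mathrm{hd}}_{s+1}\mathcal R$; $\mathcal A\Downarrow^{\mathrm{hd}}_{s+1}\mathcal A$; $t\Downarrow^{\mathrm{hd}}_s\mathcal R\Rightarrow t\cdot g\Downarrow^{\mathrm{hd}}_{s+1}\mathcal R\,g$; $t\Downarrow^{\mathrm{hd}}_s\mathcal R\,g\Rightarrow t\cdot h\Downarrow^{\mathrm{hd}}_{s+1}\mathcal R\,g\,h$; and the three clauses for $t\cdot u$, $t\cdot m$ above (heads $\lambda b$ and $\mathcal R\,g\,h$) with the last premise and the conclusion replaced by head evaluation to the same $w$. *)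

theory Defs
  imports Main "HOL-Library.FSet" "HOL-Library.Countable"
begin

section \<open>Raw terms\<close>

text \<open>\<open>Op f k ts\<close> is the node with operator code \<open>f\<close> and binder count \<open>k\<close>; the \<open>k\<close> lowest
  de Bruijn indices are bound in each element of \<open>ts\<close>. Operator codes are natural numbers, of
  which RGA uses ten; all other nodes are raw terms that are not well-formed.\<close>

datatype trm = Var nat | Op nat nat "trm list"

abbreviation "tBot \<equiv> Op 0 0 []"
abbreviation "tZero \<equiv> Op 1 0 []"
abbreviation "tRec \<equiv> Op 2 0 []"
abbreviation "tAll \<equiv> Op 3 0 []"
abbreviation "tSuc t \<equiv> Op 4 0 [t]"
abbreviation tNot (\<open>\<^bold>\<not> _\<close> [75] 75) where "\<^bold>\<not> t \<equiv> Op 5 0 [t]"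
abbreviation "tLam b \<equiv> Op 6 1 [b]"
abbreviation tEq (infix \<open>\<^bold>=\<close> 70) where "t \<^bold>= u \<equiv> Op 7 0 [t, u]"
abbreviation tOr (infixr \<open>\<^bold>\<or>\<close> 65) where "t \<^bold>\<or> u \<equiv> Op 8 0 [t, u]"
abbreviation tApp (infixl \<open>\<cdot>\<close> 90) where "t \<cdot> u \<equiv> Op 9 0 [t, u]"

text \<open>Triples of operator code, binder count and arity.\<close>

definition rga_signature :: "(nat \<times> nat \<times> nat) set" where
  "rga_signature =
    {(0, 0, 0), (1, 0, 0), (2, 0, 0), (3, 0, 0), (4, 0, 1), (5, 0, 1), (6, 1, 1),
     (7, 0, 2), (8, 0, 2), (9, 0, 2)}"

fun well_formed :: "trm \<Rightarrow> bool" where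
  "well_formed (Var i) \<longleftrightarrow> True"
| "well_formed (Op f k ts) \<longleftrightarrow> (f, k, length ts) \<in> rga_signature \<and> (\<forall>t \<in> set ts. well_formed t)"

abbreviation tNeq (infix \<open>\<^bold>\<noteq>\<close> 70) where "t \<^bold>\<noteq> u \<equiv> \<^bold>\<not> (t \<^bold>= u)"
abbreviation "isN t \<equiv> t \<^bold>= t"
abbreviation "isB t \<equiv> t \<^bold>\<or> \<^bold>\<not> t"
abbreviation tAnd (infixr \<open>\<^bold>\<and>\<close> 68) where "t \<^bold>\<and> u \<equiv> \<^bold>\<not> (\<^bold>\<not> t \<^bold>\<or> \<^bold>\<not> u)"

fun num :: "nat \<Rightarrow> trm" where
  "num 0 = tZero"
| "num (Suc n) = tSuc (num n)"

fun fv :: "trm \<Rightarrow> nat set" where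
  "fv (Var i) = {i}"
| "fv (Op f k ts) = {i. \<exists>t \<in> set ts. i + k \<in> fv t}"

text \<open>\<open>lift n d t\<close> increases by \<open>n\<close> all free indices of \<open>t\<close> that are at least \<open>d\<close>.\<close>

fun lift :: "nat \<Rightarrow> nat \<Rightarrow> trm \<Rightarrow> trm" where
  "lift n d (Var i) = Var (if i < d then i else i + n)"
| "lift n d (Op f k ts) = Op f k (map (lift n (d + k)) ts)"

abbreviation up :: "trm \<Rightarrow> trm" (\<open>\<up>_\<close> [100] 100) where "\<up>t \<equiv> lift 1 0 t"
abbreviation up_ctx :: "trm fset \<Rightarrow> trm fset" (\<open>\<Up>_\<close> [100] 100) where "\<Up>\<Gamma> \<equiv> up |`| \<Gamma>"

text \<open>\<open>subst i s t\<close> is \<open>[v\<^sub>i \<mapsto> s]t\<close>; no index is decremented.\<close>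

fun subst :: "nat \<Rightarrow> trm \<Rightarrow> trm \<Rightarrow> trm" where
  "subst i s (Var j) = (if j = i then s else Var j)"
| "subst i s (Op f k ts) = Op f k (map (subst (i + k) (lift k 0 s)) ts)"

text \<open>\<open>inst d u b\<close> replaces index \<open>d\<close> in \<open>b\<close> by \<open>u\<close> and decrements the free indices above \<open>d\<close>.\<close>

fun inst :: "nat \<Rightarrow> trm \<Rightarrow> trm \<Rightarrow> trm" where
  "inst d u (Var j) = (if j < d then Var j else if j = d then u else Var (j - 1))"
| "inst d u (Op f k ts) = Op f k (map (inst (d + k) (lift k 0 u)) ts)"

abbreviation beta :: "trm \<Rightarrow> trm \<Rightarrow> trm" where "beta b u \<equiv> inst 0 u b"


section \<open>Head steps\<close>

inductive head_step :: "trm \<Rightarrow> trm \<Rightarrow> bool" (infix \<open>\<triangleright>\<close> 50) where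
  step_beta: "well_formed t \<Longrightarrow> tLam b \<cdot> t \<triangleright> beta b t"
| step_rec0: "well_formed h \<Longrightarrow> tRec \<cdot> g \<cdot> h \<cdot> tZero \<triangleright> g"
| step_recS: "well_formed g \<Longrightarrow>
    tRec \<cdot> g \<cdot> h \<cdot> tSuc (num n) \<triangleright> h \<cdot> num n \<cdot> (tRec \<cdot> g \<cdot> h \<cdot> num n)"
| step_app: "t \<triangleright> t' \<Longrightarrow> t \<cdot> u \<triangleright> t' \<cdot> u"


section \<open>Proofs\<close>

type_synonym sequent = "trm fset \<times> trm"
type_synonym derivation = "sequent list"

text \<open>\<open>\<Gamma> \<turnstile> c\<close> denotes the sequent itself; that it holds is written \<open>derivable (\<Gamma> \<turnstile> c)\<close>.\<close>

abbreviation sequent :: "trm fset \<Rightarrow> trm \<Rightarrow> sequent" (infix \<open>\<turnstile>\<close> 55) where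
  "\<Gamma> \<turnstile> c \<equiv> (\<Gamma>, c)"

text \<open>\<open>follows S J\<close>: the sequent \<open>J\<close> is the conclusion of a rule all of whose premises are in
  \<open>S\<close>.\<close>

inductive follows :: "sequent set \<Rightarrow> sequent \<Rightarrow> bool" for S :: "sequent set" where
  hyp: "well_formed c \<Longrightarrow> follows S (finsert c \<Gamma> \<turnstile> c)"
| weaken: "(\<Gamma> \<turnstile> c) \<in> S \<Longrightarrow> follows S (finsert a \<Gamma> \<turnstile> c)"
| cut: "(\<Gamma> \<turnstile> a) \<in> S \<Longrightarrow> (finsert a \<Gamma> \<turnstile> c) \<in> S \<Longrightarrow> follows S (\<Gamma> \<turnstile> c)"
| substitution: "(\<Gamma> \<turnstile> c) \<in> S \<Longrightarrow> (\<forall>a. a |\<in>| \<Gamma> \<longrightarrow> well_formed a) \<Longrightarrow> well_formed c \<Longrightarrow> well_formed s \<Longrightarrow>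
    follows S (subst v s |`| \<Gamma> \<turnstile> subst v s c)"
| true_I: "(\<Gamma> \<turnstile> a) \<in> S \<Longrightarrow> follows S (\<Gamma> \<turnstile> a \<^bold>= num 1)"
| true_E: "(\<Gamma> \<turnstile> a \<^bold>= num 1) \<in> S \<Longrightarrow> follows S (\<Gamma> \<turnstile> a)"
| false_I: "(\<Gamma> \<turnstile> \<^bold>\<not> a) \<in> S \<Longrightarrow> follows S (\<Gamma> \<turnstile> a \<^bold>= num 0)"
| false_E: "(\<Gamma> \<turnstile> a \<^bold>= num 0) \<in> S \<Longrightarrow> follows S (\<Gamma> \<turnstile> \<^bold>\<not> a)"
| not_E: "(\<Gamma> \<turnstile> \<^bold>\<not> a) \<in> S \<Longrightarrow> (\<Gamma> \<turnstile> a) \<in> S \<Longrightarrow> well_formed c \<Longrightarrow> follows S (\<Gamma> \<turnstile> c)"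
| notnot_I: "(\<Gamma> \<turnstile> a) \<in> S \<Longrightarrow> follows S (\<Gamma> \<turnstile> \<^bold>\<not> \<^bold>\<not> a)"
| notnot_E: "(\<Gamma> \<turnstile> \<^bold>\<not> \<^bold>\<not> a) \<in> S \<Longrightarrow> follows S (\<Gamma> \<turnstile> a)"
| or_I1: "(\<Gamma> \<turnstile> a) \<in> S \<Longrightarrow> well_formed b \<Longrightarrow> follows S (\<Gamma> \<turnstile> a \<^bold>\<or> b)"
| or_I2: "(\<Gamma> \<turnstile> b) \<in> S \<Longrightarrow> well_formed a \<Longrightarrow> follows S (\<Gamma> \<turnstile> a \<^bold>\<or> b)"
| not_or_I: "(\<Gamma> \<turnstile> \<^bold>\<not> a) \<in> S \<Longrightarrow> (\<Gamma> \<turnstile> \<^bold>\<not> b) \<in> S \<Longrightarrow> follows S (\<Gamma> \<turnstile> \<^bold>\<not> (a \<^bold>\<or> b))"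
| or_E: "(\<Gamma> \<turnstile> a \<^bold>\<or> b) \<in> S \<Longrightarrow> (finsert a \<Gamma> \<turnstile> c) \<in> S \<Longrightarrow> (finsert b \<Gamma> \<turnstile> c) \<in> S \<Longrightarrow>
    follows S (\<Gamma> \<turnstile> c)"
| not_or_E1: "(\<Gamma> \<turnstile> \<^bold>\<not> (a \<^bold>\<or> b)) \<in> S \<Longrightarrow> follows S (\<Gamma> \<turnstile> \<^bold>\<not> a)"
| not_or_E2: "(\<Gamma> \<turnstile> \<^bold>\<not> (a \<^bold>\<or> b)) \<in> S \<Longrightarrow> follows S (\<Gamma> \<turnstile> \<^bold>\<not> b)"
  (* isN a abbreviates a = a, so the two directions of this rule coincide *)
| isN_iff: "(\<Gamma> \<turnstile> a \<^bold>= a) \<in> S \<Longrightarrow> follows S (\<Gamma> \<turnstile> isN a)"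
| eq_sym: "(\<Gamma> \<turnstile> a \<^bold>= b) \<in> S \<Longrightarrow> follows S (\<Gamma> \<turnstile> b \<^bold>= a)"
| eq_subst: "(\<Gamma> \<turnstile> a \<^bold>= b) \<in> S \<Longrightarrow> (\<Gamma> \<turnstile> subst v a p) \<in> S \<Longrightarrow> well_formed p \<Longrightarrow>
    follows S (\<Gamma> \<turnstile> subst v b p)"
| neq_sym: "(\<Gamma> \<turnstile> a \<^bold>\<noteq> b) \<in> S \<Longrightarrow> follows S (\<Gamma> \<turnstile> b \<^bold>\<noteq> a)"
| eq_bool_I: "(\<Gamma> \<turnstile> isN a) \<in> S \<Longrightarrow> (\<Gamma> \<turnstile> isN b) \<in> S \<Longrightarrow> follows S (\<Gamma> \<turnstile> isB (a \<^bold>= b))"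
| eq_bool_E: "(\<Gamma> \<turnstile> isB (a \<^bold>= b)) \<in> S \<Longrightarrow> follows S (\<Gamma> \<turnstile> isN a \<^bold>\<and> isN b)"
| zero_N: "follows S (\<Gamma> \<turnstile> isN tZero)"
| suc_N_I: "(\<Gamma> \<turnstile> isN a) \<in> S \<Longrightarrow> follows S (\<Gamma> \<turnstile> isN (tSuc a))"
| suc_N_E: "(\<Gamma> \<turnstile> isN (tSuc a)) \<in> S \<Longrightarrow> follows S (\<Gamma> \<turnstile> isN a)"
| suc_neq_zero: "(\<Gamma> \<turnstile> isN a) \<in> S \<Longrightarrow> follows S (\<Gamma> \<turnstile> tSuc a \<^bold>\<noteq> tZero)"
| suc_neq_I: "(\<Gamma> \<turnstile> a \<^bold>\<noteq> b) \<in> S \<Longrightarrow> follows S (\<Gamma> \<turnstile> tSuc a \<^bold>\<noteq> tSuc b)"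
| suc_neq_E: "(\<Gamma> \<turnstile> tSuc a \<^bold>\<noteq> tSuc b) \<in> S \<Longrightarrow> follows S (\<Gamma> \<turnstile> a \<^bold>\<noteq> b)"
| suc_inj: "(\<Gamma> \<turnstile> tSuc a \<^bold>= tSuc b) \<in> S \<Longrightarrow> follows S (\<Gamma> \<turnstile> a \<^bold>= b)"
| bot_E: "(\<Gamma> \<turnstile> isN tBot) \<in> S \<Longrightarrow> well_formed p \<Longrightarrow> follows S (\<Gamma> \<turnstile> p)"
| induction: "(\<Gamma> \<turnstile> subst i tZero c) \<in> S \<Longrightarrow>
    (finsert (isN (Var i)) (finsert c \<Gamma>) \<turnstile> subst i (tSuc (Var i)) c) \<in> S \<Longrightarrow>
    (\<Gamma> \<turnstile> isN a) \<in> S \<Longrightarrow> well_formed c \<Longrightarrow> (\<forall>b. b |\<in>| \<Gamma> \<longrightarrow> i \<notin> fv b) \<Longrightarrow>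
    follows S (\<Gamma> \<turnstile> subst i a c)"
| conv_expand: "c \<triangleright> c' \<Longrightarrow> (\<Gamma> \<turnstile> c') \<in> S \<Longrightarrow> follows S (\<Gamma> \<turnstile> c)"
| conv_reduce: "c \<triangleright> c' \<Longrightarrow> (\<Gamma> \<turnstile> c) \<in> S \<Longrightarrow> follows S (\<Gamma> \<turnstile> c')"
| conv_eq: "c \<triangleright> c' \<Longrightarrow> (\<Gamma> \<turnstile> isN c') \<in> S \<Longrightarrow> follows S (\<Gamma> \<turnstile> c \<^bold>= c')"
| rec_suc: "(\<Gamma> \<turnstile> isN m) \<in> S \<Longrightarrow> (\<Gamma> \<turnstile> isN (h \<cdot> m \<cdot> (tRec \<cdot> g \<cdot> h \<cdot> m))) \<in> S \<Longrightarrow> well_formed g \<Longrightarrow>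
    follows S (\<Gamma> \<turnstile> (tRec \<cdot> g \<cdot> h \<cdot> tSuc m) \<^bold>= (h \<cdot> m \<cdot> (tRec \<cdot> g \<cdot> h \<cdot> m)))"
| all_I: "(finsert (isN (Var 0)) (\<Up>\<Gamma>) \<turnstile> \<up>f \<cdot> Var 0) \<in> S \<Longrightarrow> follows S (\<Gamma> \<turnstile> tAll \<cdot> f)"
| all_E: "(\<Gamma> \<turnstile> tAll \<cdot> f) \<in> S \<Longrightarrow> (\<Gamma> \<turnstile> isN a) \<in> S \<Longrightarrow> follows S (\<Gamma> \<turnstile> f \<cdot> a)"
| not_all_I: "(\<Gamma> \<turnstile> \<^bold>\<not> (f \<cdot> a)) \<in> S \<Longrightarrow> (\<Gamma> \<turnstile> isN a) \<in> S \<Longrightarrow> follows S (\<Gamma> \<turnstile> \<^bold>\<not> (tAll \<cdot> f))"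
| not_all_E: "(\<Gamma> \<turnstile> \<^bold>\<not> (tAll \<cdot> f)) \<in> S \<Longrightarrow>
    (finsert (isN (Var 0)) (finsert (\<^bold>\<not> (\<up>f \<cdot> Var 0)) (\<Up>\<Gamma>)) \<turnstile> \<up>c) \<in> S \<Longrightarrow>
    follows S (\<Gamma> \<turnstile> c)"

definition valid_proof :: "derivation \<Rightarrow> bool" where
  "valid_proof P \<longleftrightarrow> (\<forall>i < length P. follows (set (take i P)) (P ! i))"

definition proves :: "derivation \<Rightarrow> sequent \<Rightarrow> bool" (infix \<open>\<rhd>\<close> 50) where
  "P \<rhd> J \<longleftrightarrow> valid_proof P \<and> J \<in> set P"

definition derivable :: "sequent \<Rightarrow> bool" where
  "derivable J \<longleftrightarrow> (\<exists>P. P \<rhd> J)"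


section \<open>Evaluation\<close>

text \<open>The parameter \<open>code\<close> of the evaluation relations is the Goedel coding of proofs. It is kept
  arbitrary; the following shows that injective codings exist.\<close>

instance trm :: countable
  by countable_datatype

lemma ex_injective_coding: "\<exists>code :: derivation \<Rightarrow> nat. inj code"
  by (rule ex_inj)

abbreviation tt :: nat where "tt \<equiv> 1"
abbreviation ff :: nat where "ff \<equiv> 0"

datatype head = HLam trm | HRec | HRec1 trm | HRec2 trm trm | HAll

inductive
  val_eval :: "(derivation \<Rightarrow> nat) \<Rightarrow> trm \<Rightarrow> nat \<Rightarrow> nat \<Rightarrow> bool" (\<open>_ \<tturnstile> _ \<Down>\<^bsub>_\<^esub> _\<close> [51, 51, 0, 51] 50) and
  head_eval :: "(derivation \<Rightarrow> nat) \<Rightarrow> trm \<Rightarrow> nat \<Rightarrow> head \<Rightarrow> bool" (\<open>_ \<tturnstile> _ \<Down>hd\<^bsub>_\<^esub> _\<close> [51, 51, 0, 51] 50)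
  for code :: "derivation \<Rightarrow> nat"
where
  val_zero: "code \<tturnstile> tZero \<Down>\<^bsub>s + 1\<^esub> 0"
| val_suc: "code \<tturnstile> a \<Down>\<^bsub>s\<^esub> n \<Longrightarrow> code \<tturnstile> tSuc a \<Down>\<^bsub>s + 1\<^esub> n + 1"
| val_eq: "code \<tturnstile> a \<Down>\<^bsub>s\<^esub> m \<Longrightarrow> code \<tturnstile> b \<Down>\<^bsub>s\<^esub> n \<Longrightarrow>
    code \<tturnstile> (a \<^bold>= b) \<Down>\<^bsub>s + 1\<^esub> (if m = n then tt else ff)"
| val_not_ff: "code \<tturnstile> a \<Down>\<^bsub>s\<^esub> ff \<Longrightarrow> code \<tturnstile> (\<^bold>\<not> a) \<Down>\<^bsub>s + 1\<^esub> tt"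
| val_not_tt: "code \<tturnstile> a \<Down>\<^bsub>s\<^esub> tt \<Longrightarrow> code \<tturnstile> (\<^bold>\<not> a) \<Down>\<^bsub>s + 1\<^esub> ff"
| val_or_tt: "code \<tturnstile> a \<Down>\<^bsub>s\<^esub> tt \<or> code \<tturnstile> b \<Down>\<^bsub>s\<^esub> tt \<Longrightarrow> code \<tturnstile> (a \<^bold>\<or> b) \<Down>\<^bsub>s + 1\<^esub> tt"
| val_or_ff: "code \<tturnstile> a \<Down>\<^bsub>s\<^esub> ff \<Longrightarrow> code \<tturnstile> b \<Down>\<^bsub>s\<^esub> ff \<Longrightarrow> code \<tturnstile> (a \<^bold>\<or> b) \<Down>\<^bsub>s + 1\<^esub> ff"
| val_beta: "code \<tturnstile> t \<Down>hd\<^bsub>s\<^esub> HLam b \<Longrightarrow> code \<tturnstile> beta b u \<Down>\<^bsub>s\<^esub> r \<Longrightarrow> code \<tturnstile> t \<cdot> u \<Down>\<^bsub>s + 1\<^esub> r"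
| val_rec0: "code \<tturnstile> t \<Down>hd\<^bsub>s\<^esub> HRec2 g h \<Longrightarrow> code \<tturnstile> m \<Down>\<^bsub>s\<^esub> 0 \<Longrightarrow> code \<tturnstile> g \<Down>\<^bsub>s\<^esub> r \<Longrightarrow>
    code \<tturnstile> t \<cdot> m \<Down>\<^bsub>s + 1\<^esub> r"
| val_recS: "code \<tturnstile> t \<Down>hd\<^bsub>s\<^esub> HRec2 g h \<Longrightarrow> code \<tturnstile> m \<Down>\<^bsub>s\<^esub> k + 1 \<Longrightarrow>
    code \<tturnstile> h \<cdot> num k \<cdot> (tRec \<cdot> g \<cdot> h \<cdot> num k) \<Down>\<^bsub>s\<^esub> r \<Longrightarrow> code \<tturnstile> t \<cdot> m \<Down>\<^bsub>s + 1\<^esub> r"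
| val_all_tt: "code \<tturnstile> t \<Down>hd\<^bsub>s\<^esub> HAll \<Longrightarrow> code P \<le> s \<Longrightarrow>
    P \<rhd> ({|isN (Var 0)|} \<turnstile> \<up>u \<cdot> Var 0) \<Longrightarrow> code \<tturnstile> t \<cdot> u \<Down>\<^bsub>s + 1\<^esub> tt"
| val_all_ff: "code \<tturnstile> t \<Down>hd\<^bsub>s\<^esub> HAll \<Longrightarrow> code P \<le> s \<Longrightarrow>
    P \<rhd> ({||} \<turnstile> \<^bold>\<not> (u \<cdot> num i)) \<Longrightarrow> code \<tturnstile> t \<cdot> u \<Down>\<^bsub>s + 1\<^esub> ff"
| hd_lam: "code \<tturnstile> tLam b \<Down>hd\<^bsub>s + 1\<^esub> HLam b"
| hd_rec: "code \<tturnstile> tRec \<Down>hd\<^bsub>s + 1\<^esub> HRec"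
| hd_all: "code \<tturnstile> tAll \<Down>hd\<^bsub>s + 1\<^esub> HAll"
| hd_rec1: "code \<tturnstile> t \<Down>hd\<^bsub>s\<^esub> HRec \<Longrightarrow> code \<tturnstile> t \<cdot> g \<Down>hd\<^bsub>s + 1\<^esub> HRec1 g"
| hd_rec2: "code \<tturnstile> t \<Down>hd\<^bsub>s\<^esub> HRec1 g \<Longrightarrow> code \<tturnstile> t \<cdot> h \<Down>hd\<^bsub>s + 1\<^esub> HRec2 g h"
| hd_beta: "code \<tturnstile> t \<Down>hd\<^bsub>s\<^esub> HLam b \<Longrightarrow> code \<tturnstile> beta b u \<Down>hd\<^bsub>s\<^esub> w \<Longrightarrow> code \<tturnstile> t \<cdot> u \<Down>hd\<^bsub>s + 1\<^esub> w"
| hd_rec0: "code \<tturnstile> t \<Down>hd\<^bsub>s\<^esub> HRec2 g h \<Longrightarrow> code \<tturnstile> m \<Down>\<^bsub>s\<^esub> 0 \<Longrightarrow> code \<tturnstile> g \<Down>hd\<^bsub>s\<^esub> w \<Longrightarrow>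
    code \<tturnstile> t \<cdot> m \<Down>hd\<^bsub>s + 1\<^esub> w"
| hd_recS: "code \<tturnstile> t \<Down>hd\<^bsub>s\<^esub> HRec2 g h \<Longrightarrow> code \<tturnstile> m \<Down>\<^bsub>s\<^esub> k + 1 \<Longrightarrow>
    code \<tturnstile> h \<cdot> num k \<cdot> (tRec \<cdot> g \<cdot> h \<cdot> num k) \<Down>hd\<^bsub>s\<^esub> w \<Longrightarrow> code \<tturnstile> t \<cdot> m \<Down>hd\<^bsub>s + 1\<^esub> w"

end

theory Submission
  imports Defs
begin

text \<open>
  \<^bold>\<open>From evaluation to derivability.\<close> An evaluation can be replayed as a derivation: every value
  clause is a derived rule of the calculus, and a head evaluation of \<open>t\<close> is a sequence of head steps
  and of replacements of recursion arguments by equal numerals, so that what is derivable about the head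
  applied to some arguments is derivable about \<open>t\<close> applied to them (\<open>eval_derivable\<close>).

  \<^bold>\<open>From derivability to evaluation.\<close> One would like to show by induction on derivations that every
  rule preserves evaluation to \<open>tt\<close> under all substitutions. This breaks down at the quantifier: that
  \<open>tAll \<cdot> f\<close> evaluates to \<open>tt\<close> only says that some derivation of its generic instance exists, and
  nothing is known about that derivation when an instance \<open>f \<cdot> a\<close> has to be evaluated. The remedy is
  Kleene's slash: a stage-free evaluation \<open>slash_val\<close>, in which a universal statement gets the value
  \<open>tt\<close> iff it is derivable \<^emph>\<open>and\<close> all its numeral instances have the value \<open>tt\<close>, and the value \<open>ff\<close>
  iff some numeral instance has the value \<open>ff\<close>. It has three properties.

  \<^item> It is contained in evaluation (\<open>slash_eval\<close>): a derivation of \<open>tAll \<cdot> f\<close> yields one of the generic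
    instance, and a false numeral instance is refutable because evaluations can be replayed.

  \<^item> It is single-valued, without any appeal to the consistency of the calculus (\<open>slash_unique\<close>), and
    terms with the same value are interchangeable in every context (\<open>slash_replace\<close>).

  \<^item> The calculus is sound for it (\<open>derivable_sound\<close>): in a derivable sequent, every substitution of
    well-formed terms that makes all hypotheses true makes the conclusion true. For the introduction
    of the quantifier, the two halves of the slash come from different sources: the numeral
    instances are true by the induction hypothesis, and the derivability of the universal statement
    follows from the sequent itself, by substitution and by cutting out the hypotheses, which are
    derivable because they are true.

  Thus a derivable sequent \<open>{||} \<turnstile> c\<close>, taken with the identity substitution, gives \<open>slash_val c tt\<close>, hence an evaluation of \<open>c\<close>.
\<close>

(* With the number 1 kept as it is, the binder count of the abstraction operator, the lifting
   by one and the truth value tt match syntactically in rewrite rules. *)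
declare One_nat_def [simp del]

section \<open>Simultaneous substitution\<close>

text \<open>Lifting, \<open>subst\<close> and \<open>inst\<close> are all instances of one simultaneous substitution, so that their
  commutation laws are consequences of the composition law \<open>ssub_ssub\<close>. As usual with de Bruijn
  indices, composition is proved for renamings first.\<close>

definition shift :: "nat \<Rightarrow> (nat \<Rightarrow> trm) \<Rightarrow> nat \<Rightarrow> trm" where
  "shift k \<sigma> i = (if i < k then Var i else lift k 0 (\<sigma> (i - k)))"

fun ssub :: "(nat \<Rightarrow> trm) \<Rightarrow> trm \<Rightarrow> trm" where
  "ssub \<sigma> (Var i) = \<sigma> i"
| "ssub \<sigma> (Op f k ts) = Op f k (map (ssub (shift k \<sigma>)) ts)"

lemma lift_0 [simp]: "lift 0 d t = t"
  by (induction t arbitrary: d) (auto simp: map_idI)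

lemma shift_0 [simp]: "shift 0 \<sigma> = \<sigma>"
  by (auto simp: shift_def)

lemma lift_eq_ssub: "lift n d = ssub (\<lambda>i. Var (if i < d then i else i + n))"
proof
  have sh: "shift k (\<lambda>i. Var (if i < d then i else i + n)) =
      (\<lambda>i. Var (if i < d + k then i else i + n))" for k d
    by (auto simp: shift_def fun_eq_iff)
  show "lift n d t = ssub (\<lambda>i. Var (if i < d then i else i + n)) t" for t
    by (induction t arbitrary: d) (auto simp: sh)
qed

lemma up_eq_ssub: "lift n 0 = ssub (\<lambda>i. Var (i + n))"
  by (simp add: lift_eq_ssub)

lemma ssub_rename:
  "ssub \<sigma> (ssub (\<lambda>i. Var (\<rho> i)) t) = ssub (\<lambda>i. \<sigma> (\<rho> i)) t"
proof (induction t arbitrary: \<sigma> \<rho>)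
  case (Op f k ts)
  have "shift k (\<lambda>i. Var (\<rho> i)) = (\<lambda>i. Var (if i < k then i else \<rho> (i - k) + k))"
    by (auto simp: shift_def)
  moreover have "(\<lambda>i. shift k \<sigma> (if i < k then i else \<rho> (i - k) + k)) = shift k (\<lambda>i. \<sigma> (\<rho> i))"
    by (auto simp: shift_def)
  ultimately show ?case
    using Op by auto
qed simp

lemma rename_ssub:
  "ssub (\<lambda>i. Var (\<rho> i)) (ssub \<sigma> t) = ssub (\<lambda>i. ssub (\<lambda>i. Var (\<rho> i)) (\<sigma> i)) t"
proof (induction t arbitrary: \<sigma> \<rho>)
  case (Op f k ts)
  let ?\<rho> = "\<lambda>i. if i < k then i else \<rho> (i - k) + k"
  have "shift k (\<lambda>i. Var (\<rho> i)) = (\<lambda>i. Var (?\<rho> i))"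
    by (auto simp: shift_def)
  moreover have "(\<lambda>i. ssub (\<lambda>i. Var (?\<rho> i)) (shift k \<sigma> i)) =
      shift k (\<lambda>i. ssub (\<lambda>i. Var (\<rho> i)) (\<sigma> i))"
    by (auto simp: shift_def up_eq_ssub ssub_rename)
  ultimately show ?case
    using Op[of _ ?\<rho> "shift k \<sigma>"] by auto
qed simp

lemma ssub_ssub: "ssub \<tau> (ssub \<sigma> t) = ssub (\<lambda>i. ssub \<tau> (\<sigma> i)) t"
proof (induction t arbitrary: \<sigma> \<tau>)
  case (Op f k ts)
  have "(\<lambda>i. ssub (shift k \<tau>) (shift k \<sigma> i)) = shift k (\<lambda>i. ssub \<tau> (\<sigma> i))"
    by (auto simp: shift_def up_eq_ssub ssub_rename rename_ssub)
  then show ?case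
    using Op by auto
qed simp

lemma case_nat_plus_1 [simp]: "case_nat a f (i + 1) = f i"
  by (simp flip: Suc_eq_plus1)

lemma shift_Var [simp]: "shift k Var = Var"
  by (auto simp: shift_def)

lemma ssub_Var [simp]: "ssub Var t = t"
  by (induction t) (auto simp: map_idI)

lemma ssub_cong: "(\<And>i. i \<in> fv t \<Longrightarrow> \<sigma> i = \<tau> i) \<Longrightarrow> ssub \<sigma> t = ssub \<tau> t"
proof (induction t arbitrary: \<sigma> \<tau>)
  case (Op f k ts)
  have "ssub (shift k \<sigma>) t = ssub (shift k \<tau>) t" if "t \<in> set ts" for t
    using that Op.prems by (intro Op.IH) (auto simp: shift_def, metis le_add_diff_inverse2 leI)
  then show ?case by auto
qed simp

lemma finite_fv: "finite (fv t)"
proof (induction t)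
  case (Op f k ts)
  have "fv (Op f k ts) = (\<Union>t\<in>set ts. (\<lambda>i. i + k) -` fv t)"
    by auto
  then show ?case
    using Op by (auto intro!: finite_vimageI simp: inj_def)
qed simp

lemma subst_eq_ssub: "subst i s = ssub (Var(i := s))"
proof
  have sh: "shift k (Var(i := s)) = Var(i + k := lift k 0 s)" for k i s
    by (auto simp: shift_def fun_eq_iff)
  show "subst i s t = ssub (Var(i := s)) t" for t
    by (induction t arbitrary: i s) (auto simp: sh)
qed

lemma beta_eq_ssub: "beta b u = ssub (case_nat u Var) b"
proof -
  have sh: "shift k (\<lambda>j. if j < d then Var j else if j = d then u else Var (j - 1)) =
      (\<lambda>j. if j < d + k then Var j else if j = d + k then lift k 0 u else Var (j - 1))" for k d u
    by (auto simp: shift_def fun_eq_iff)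
  have "inst d u b = ssub (\<lambda>j. if j < d then Var j else if j = d then u else Var (j - 1)) b" for d
    by (induction b arbitrary: d u) (auto simp: sh)
  moreover have "(\<lambda>j. if j < 0 then Var j else if j = 0 then u else Var (j - 1)) = case_nat u Var"
    by (auto simp: fun_eq_iff split: nat.split)
  ultimately show ?thesis by simp
qed

lemma ssub_beta: "ssub \<sigma> (beta b u) = beta (ssub (shift 1 \<sigma>) b) (ssub \<sigma> u)"
proof -
  have "(\<lambda>i. ssub \<sigma> (case i of 0 \<Rightarrow> u | Suc j \<Rightarrow> Var j)) =
      (\<lambda>i. ssub (case_nat (ssub \<sigma> u) Var) (shift 1 \<sigma> i))"
    by (auto simp: shift_def up_eq_ssub ssub_rename fun_eq_iff split: nat.split)
  then show ?thesis
    by (simp add: beta_eq_ssub ssub_ssub)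
qed

lemma ssub_subst: "ssub \<sigma> (subst i s t) = ssub (\<sigma>(i := ssub \<sigma> s)) t"
proof -
  have "(\<lambda>j. ssub \<sigma> ((Var(i := s)) j)) = \<sigma>(i := ssub \<sigma> s)"
    by auto
  then show ?thesis
    by (simp add: subst_eq_ssub ssub_ssub)
qed

lemma ssub_case_nat_up: "ssub (case_nat u \<sigma>) (\<up>t) = ssub \<sigma> t"
  by (simp add: up_eq_ssub ssub_rename)

lemma beta_up: "beta (\<up>t) u = t"
  by (simp add: beta_eq_ssub ssub_case_nat_up)

lemma well_formed_rename: "well_formed (ssub (\<lambda>i. Var (\<rho> i)) t) = well_formed t"
proof (induction t arbitrary: \<rho>)
  case (Op f k ts)
  have "shift k (\<lambda>i. Var (\<rho> i)) = (\<lambda>i. Var (if i < k then i else \<rho> (i - k) + k))"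
    by (auto simp: shift_def)
  then show ?case
    using Op by auto
qed simp

lemma well_formed_up [simp]: "well_formed (lift k 0 t) = well_formed t"
  by (simp add: up_eq_ssub well_formed_rename)

lemma well_formed_shift: "(\<And>i. well_formed (\<sigma> i)) \<Longrightarrow> well_formed (shift k \<sigma> i)"
  by (simp add: shift_def)

lemma well_formed_ssub: "(\<And>i. well_formed (\<sigma> i)) \<Longrightarrow> well_formed (ssub \<sigma> t) = well_formed t"
proof (induction t arbitrary: \<sigma>)
  case (Op f k ts)
  have "well_formed (ssub (shift k \<sigma>) t) = well_formed t" if "t \<in> set ts" for t
    using that Op by (simp add: well_formed_shift)
  then show ?case by simp
qed simp

lemma well_formed_beta: "well_formed u \<Longrightarrow> well_formed (beta b u) = well_formed b"
  by (auto simp: beta_eq_ssub intro!: well_formed_ssub split: nat.split)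

lemma well_formed_rga [simp]:
  "well_formed tBot" "well_formed tZero" "well_formed tRec" "well_formed tAll"
  "well_formed (tSuc a) = well_formed a" "well_formed (\<^bold>\<not> a) = well_formed a"
  "well_formed (tLam a) = well_formed a"
  "well_formed (a \<^bold>= b) = (well_formed a \<and> well_formed b)"
  "well_formed (a \<^bold>\<or> b) = (well_formed a \<and> well_formed b)"
  "well_formed (a \<cdot> b) = (well_formed a \<and> well_formed b)"
  by (auto simp: rga_signature_def)

declare well_formed.simps(2) [simp del]

lemma well_formed_num [simp]: "well_formed (num n)"
  by (induction n) auto

lemma num_plus_1 [simp]: "num (n + 1) = tSuc (num n)"
  by (simp flip: Suc_eq_plus1)

lemma num_1 [simp]: "num 1 = tSuc tZero"
  using num_plus_1[of 0] by simp

lemma ssub_num [simp]: "ssub \<sigma> (num n) = num n"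
  by (induction n) auto

lemma lift_num [simp]: "lift k d (num n) = num n"
  by (simp add: lift_eq_ssub)

section \<open>Derivability\<close>

text \<open>Derivability is closed under the rules, since proofs can be concatenated. Conversely, every
  entry of a proof is derivable, so properties of derivable sequents can be proved by induction with
  one step per rule.\<close>

lemma follows_mono: "follows S J \<Longrightarrow> S \<subseteq> S' \<Longrightarrow> follows S' J"
  by (induction rule: follows.induct)
    (rule follows.intros; (assumption | rule subsetD, assumption, assumption))+

lemma valid_proof_snoc: "valid_proof P \<Longrightarrow> follows (set P) J \<Longrightarrow> valid_proof (P @ [J])"
  by (auto simp: valid_proof_def nth_append less_Suc_eq)

lemma valid_proof_append: "valid_proof P \<Longrightarrow> valid_proof Q \<Longrightarrow> valid_proof (P @ Q)"
  unfolding valid_proof_def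
proof (intro allI impI)
  fix i
  assume P: "\<forall>i<length P. follows (set (take i P)) (P ! i)"
    and Q: "\<forall>i<length Q. follows (set (take i Q)) (Q ! i)" and i: "i < length (P @ Q)"
  show "follows (set (take i (P @ Q))) ((P @ Q) ! i)"
  proof (cases "i < length P")
    case False
    then have "follows (set (take (i - length P) Q)) (Q ! (i - length P))"
      using Q i by simp
    then show ?thesis
      using False by (auto simp: nth_append elim!: follows_mono)
  qed (use P in \<open>simp add: nth_append\<close>)
qed

lemma derivable_from2:
  assumes "follows {K1, K2} J" and "derivable K1" and "derivable K2"
  shows "derivable J"
proof -
  obtain P Q where "valid_proof P" "K1 \<in> set P" "valid_proof Q" "K2 \<in> set Q"
    using assms(2,3) by (auto simp: derivable_def proves_def)
  then have "valid_proof ((P @ Q) @ [J])"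
    using assms(1) by (intro valid_proof_snoc valid_proof_append) (auto intro: follows_mono)
  then show ?thesis
    unfolding derivable_def proves_def by (metis in_set_conv_decomp)
qed

lemma derivable_from1: "follows {K} J \<Longrightarrow> derivable K \<Longrightarrow> derivable J"
  using derivable_from2[of K K J] by simp

lemma derivable_from0:
  assumes "follows {} J"
  shows "derivable J"
proof -
  have "valid_proof [J]"
    using assms by (simp add: valid_proof_def)
  then show ?thesis
    unfolding derivable_def proves_def by (metis list.set_intros(1))
qed

lemma derivable_induct [consumes 1, case_names step]:
  assumes "derivable J"
    and step: "\<And>S J. (\<And>K. K \<in> S \<Longrightarrow> derivable K \<and> Q K) \<Longrightarrow> follows S J \<Longrightarrow> derivable J \<Longrightarrow> Q J"
  shows "Q J"
proof -
  obtain P where P: "valid_proof P" and J: "J \<in> set P"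
    using assms(1) by (auto simp: derivable_def proves_def)
  have der: "derivable K" if "K \<in> set P" for K
    using P that by (auto simp: derivable_def proves_def)
  have "Q (P ! i)" if "i < length P" for i
    using that
  proof (induction i rule: less_induct)
    case (less i)
    show ?case
    proof (rule step)
      show "follows (set (take i P)) (P ! i)"
        using P less.prems by (simp add: valid_proof_def)
      show "derivable (P ! i)"
        using less.prems by (simp add: der)
      show "derivable K \<and> Q K" if K: "K \<in> set (take i P)" for K
      proof -
        obtain j where "j < i" "K = P ! j"
          using K by (auto simp: in_set_conv_nth)
        then show ?thesis
          using less by (simp add: der)
      qed
    qed
  qed
  with J show ?thesis
    by (auto simp: in_set_conv_nth)
qed

lemmas derivable_hyp = derivable_from0[OF follows.hyp]
lemmas derivable_weaken = derivable_from1[OF follows.weaken[OF singletonI]]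
lemmas derivable_cut = derivable_from2[OF follows.cut[OF insertI1 insertI2[OF singletonI]]]
lemmas derivable_subst = derivable_from1[OF follows.substitution[OF singletonI]]
lemmas derivable_true_I =
  derivable_from1[OF follows.true_I[OF singletonI], unfolded num_1 num.simps(1)]
lemmas derivable_true_E =
  derivable_from1[OF follows.true_E[OF singletonI], unfolded num_1 num.simps(1)]
lemmas derivable_false_I =
  derivable_from1[OF follows.false_I[OF singletonI], unfolded num_1 num.simps(1)]
lemmas derivable_false_E =
  derivable_from1[OF follows.false_E[OF singletonI], unfolded num_1 num.simps(1)]
lemmas derivable_notnot_I = derivable_from1[OF follows.notnot_I[OF singletonI]]
lemmas derivable_or_I1 = derivable_from1[OF follows.or_I1[OF singletonI]]
lemmas derivable_or_I2 = derivable_from1[OF follows.or_I2[OF singletonI]]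
lemmas derivable_not_or_I =
  derivable_from2[OF follows.not_or_I[OF insertI1 insertI2[OF singletonI]]]
lemmas derivable_eq_sym = derivable_from1[OF follows.eq_sym[OF singletonI]]
lemmas derivable_eq_subst =
  derivable_from2[OF follows.eq_subst[OF insertI1 insertI2[OF singletonI]]]
lemmas derivable_neq_sym = derivable_from1[OF follows.neq_sym[OF singletonI]]
lemmas derivable_zero_N = derivable_from0[OF follows.zero_N]
lemmas derivable_suc_N_I = derivable_from1[OF follows.suc_N_I[OF singletonI]]
lemmas derivable_suc_neq_zero = derivable_from1[OF follows.suc_neq_zero[OF singletonI]]
lemmas derivable_suc_neq_I = derivable_from1[OF follows.suc_neq_I[OF singletonI]]
lemmas derivable_conv_eq = derivable_from1[OF follows.conv_eq[OF _ singletonI]]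
lemmas derivable_all_I = derivable_from1[OF follows.all_I[OF singletonI]]
lemmas derivable_all_E =
  derivable_from2[OF follows.all_E[OF insertI1 insertI2[OF singletonI]]]
lemmas derivable_not_all_I =
  derivable_from2[OF follows.not_all_I[OF insertI1 insertI2[OF singletonI]]]

section \<open>Substitution in derivable sequents\<close>

abbreviation wf_ctx :: "trm fset \<Rightarrow> bool" where
  "wf_ctx \<Gamma> \<equiv> \<forall>a. a |\<in>| \<Gamma> \<longrightarrow> well_formed a"

text \<open>The substitution rule replaces one variable at a time. Iterating it gives simultaneous
  substitution as long as the substituted terms do not contain the variables still to be replaced.\<close>

lemma derivable_ssub_separated:
  assumes "finite D"
    and "\<And>i. i \<in> D \<Longrightarrow> well_formed (\<sigma> i)" and "\<And>i. i \<in> D \<Longrightarrow> fv (\<sigma> i) \<inter> D = {}"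
    and "derivable (\<Gamma> \<turnstile> c)" and "wf_ctx \<Gamma>" and "well_formed c"
  defines "\<tau> \<equiv> \<lambda>D i. if i \<in> D then \<sigma> i else Var i"
  shows "derivable (ssub (\<tau> D) |`| \<Gamma> \<turnstile> ssub (\<tau> D) c)"
  using assms(1-3)
proof (induction D)
  case empty
  have "\<tau> {} = Var"
    by (auto simp: \<tau>_def)
  then have "ssub (\<tau> {}) = (\<lambda>t. t)"
    by auto
  then show ?case
    using assms(4) by simp
next
  case (insert d D)
  have wf: "well_formed (ssub (\<tau> D) t) = well_formed t" for t
    using insert.prems(1) by (intro well_formed_ssub) (auto simp: \<tau>_def)
  have "derivable (ssub (\<tau> D) |`| \<Gamma> \<turnstile> ssub (\<tau> D) c)"
    using insert by fastforce
  then have "derivable (subst d (\<sigma> d) |`| (ssub (\<tau> D) |`| \<Gamma>) \<turnstile> subst d (\<sigma> d) (ssub (\<tau> D) c))"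
    using insert.prems(1) assms(5,6) by (intro derivable_subst) (auto simp: wf)
  moreover have "subst d (\<sigma> d) \<circ> ssub (\<tau> D) = ssub (\<tau> (insert d D))"
  proof -
    have "ssub (Var(d := \<sigma> d)) (\<tau> D i) = \<tau> (insert d D) i" for i
    proof (cases "i \<in> D")
      case True
      then have "ssub (Var(d := \<sigma> d)) (\<sigma> i) = ssub Var (\<sigma> i)"
        using insert.prems(2)[of i] by (intro ssub_cong) auto
      then show ?thesis
        using True by (simp add: \<tau>_def)
    qed (simp add: \<tau>_def)
    then show ?thesis
      by (auto simp: subst_eq_ssub ssub_ssub)
  qed
  ultimately show ?case
    by (metis comp_apply fimage_fimage fset.map_comp)
qed

text \<open>The general case needs two separated substitutions: the variables are first renamed to fresh
  ones (\<open>\<rho>\<close> below), and the fresh ones are then replaced by the intended terms (\<open>\<tau>\<close> below).\<close>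

lemma derivable_ssub:
  assumes "derivable (\<Gamma> \<turnstile> c)" and "wf_ctx \<Gamma>" and "well_formed c" and wf: "\<And>i. well_formed (\<sigma> i)"
  shows "derivable (ssub \<sigma> |`| \<Gamma> \<turnstile> ssub \<sigma> c)"
proof -
  define V where "V = (\<Union>t\<in>fset (finsert c \<Gamma>). fv t)"
  have fin: "finite V"
    by (auto simp: V_def finite_fv)
  then have "finite (V \<union> (\<Union>i\<in>V. fv (\<sigma> i)))"
    by (simp add: finite_fv)
  then obtain N where "\<forall>i \<in> V \<union> (\<Union>i\<in>V. fv (\<sigma> i)). i < N"
    using finite_nat_set_iff_bounded by blast
  then have N: "\<And>i. i \<in> V \<Longrightarrow> i < N" "\<And>i j. i \<in> V \<Longrightarrow> j \<in> fv (\<sigma> i) \<Longrightarrow> j < N"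
    by auto
  define \<rho> where "\<rho> i = (if i \<in> V then Var (N + i) else Var i)" for i
  define \<tau> where "\<tau> i = (if i \<in> (+) N ` V then \<sigma> (i - N) else Var i)" for i
  have wf_\<rho>: "well_formed (ssub \<rho> t) = well_formed t" for t
    by (rule well_formed_ssub) (simp add: \<rho>_def)
  have "fv (Var (N + i)) \<inter> V = {}" for i
    using N(1)[of "N + i"] by auto
  then have "derivable (ssub \<rho> |`| \<Gamma> \<turnstile> ssub \<rho> c)"
    unfolding \<rho>_def using assms(1-3) fin by (intro derivable_ssub_separated) simp_all
  moreover have "fv (\<sigma> (i - N)) \<inter> (+) N ` V = {}" if "i \<in> (+) N ` V" for i
    using that N(2) by fastforce
  ultimately have "derivable (ssub \<tau> |`| (ssub \<rho> |`| \<Gamma>) \<turnstile> ssub \<tau> (ssub \<rho> c))"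
    unfolding \<tau>_def using assms(2,3) fin
    by (intro derivable_ssub_separated) (auto simp: wf wf_\<rho>)
  moreover have eq: "ssub \<tau> (ssub \<rho> t) = ssub \<sigma> t" if "fv t \<subseteq> V" for t
    unfolding ssub_ssub using that by (intro ssub_cong) (auto simp: \<rho>_def \<tau>_def)
  have "fv t \<subseteq> V" if "t |\<in>| finsert c \<Gamma>" for t
    using that unfolding V_def by blast
  then have "ssub \<tau> (ssub \<rho> c) = ssub \<sigma> c" "ssub \<tau> |`| (ssub \<rho> |`| \<Gamma>) = ssub \<sigma> |`| \<Gamma>"
    by (simp_all add: eq fset.map_comp cong: fset.map_cong)
  ultimately show ?thesis
    by simp
qed

text \<open>The equality rule in terms of \<open>beta\<close>: the hole of a context \<open>p\<close> is index \<open>0\<close>, and filling the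
  hole decrements the other indices, so that no fresh variable has to be chosen for it.\<close>

lemma derivable_replace:
  assumes "derivable (\<Gamma> \<turnstile> a \<^bold>= b)" and "derivable (\<Gamma> \<turnstile> beta p a)" and "well_formed p"
  shows "derivable (\<Gamma> \<turnstile> beta p b)"
proof -
  obtain N where N: "\<And>i. i \<in> fv p \<Longrightarrow> i < N"
    using finite_fv[of p] finite_nat_set_iff_bounded by metis
  define q where "q = beta p (Var N)"
  have subst_q: "subst N s q = beta p s" for s
    unfolding q_def beta_eq_ssub subst_eq_ssub ssub_ssub
    by (rule ssub_cong) (auto split: nat.split dest: N)
  have "well_formed q"
    using assms(3) by (simp add: q_def well_formed_beta)
  then show ?thesis
    using derivable_eq_subst[of q \<Gamma> a b N] assms by (simp add: subst_q)
qed

lemma derivable_cut_all: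
  assumes "\<And>a. a |\<in>| \<Gamma> \<Longrightarrow> derivable ({||} \<turnstile> a)" and "derivable (\<Gamma> \<turnstile> c)"
  shows "derivable ({||} \<turnstile> c)"
  using assms
proof (induction \<Gamma>)
  case (insert a \<Gamma>)
  have weaken: "derivable (\<Delta> \<turnstile> a)" for \<Delta>
    using insert.prems(1)[of a] by (induction \<Delta>) (auto intro: derivable_weaken)
  then show ?case
    using insert by (auto intro: derivable_cut)
qed simp

section \<open>Evaluation entails derivability\<close>

lemma derivable_num_N: "derivable (\<Gamma> \<turnstile> isN (num n))"
  by (induction n) (auto intro: derivable_zero_N derivable_suc_N_I)

lemma derivable_num_neq: "m \<noteq> n \<Longrightarrow> derivable (\<Gamma> \<turnstile> num m \<^bold>\<noteq> num n)"
proof (induction m arbitrary: n)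
  case 0
  then obtain k where "n = Suc k"
    by (cases n) auto
  then show ?case
    by (auto intro: derivable_neq_sym derivable_suc_neq_zero derivable_num_N)
next
  case (Suc m)
  then show ?case
    by (cases n) (auto intro: derivable_suc_neq_zero derivable_num_N derivable_suc_neq_I)
qed

lemma derivable_eq_trans:
  assumes "derivable (\<Gamma> \<turnstile> a \<^bold>= b)" and "derivable (\<Gamma> \<turnstile> b \<^bold>= c)" and "well_formed c"
  shows "derivable (\<Gamma> \<turnstile> a \<^bold>= c)"
  using derivable_replace[OF derivable_eq_sym[OF assms(1)], of "Var 0 \<^bold>= \<up>c"] assms(2,3)
  by (simp add: beta_up)

lemma derivable_replace_eq:
  assumes "derivable (\<Gamma> \<turnstile> a \<^bold>= b)" and "well_formed p" and "derivable (\<Gamma> \<turnstile> beta p b \<^bold>= num r)"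
  shows "derivable (\<Gamma> \<turnstile> beta p a \<^bold>= num r)"
  using derivable_replace[OF derivable_eq_sym[OF assms(1)], of "p \<^bold>= num r"] assms(2,3)
  by (simp add: beta_eq_ssub)

text \<open>Conversion yields \<open>c \<^bold>= c'\<close> only for a denoting \<open>c'\<close>; here \<open>c'\<close> denotes because it equals a
  numeral.\<close>

lemma derivable_step:
  assumes "c \<triangleright> c'" and "derivable (\<Gamma> \<turnstile> c' \<^bold>= num r)"
  shows "derivable (\<Gamma> \<turnstile> c \<^bold>= num r)"
proof -
  have "derivable (\<Gamma> \<turnstile> isN c')"
    using derivable_replace[OF derivable_eq_sym[OF assms(2)], of "Var 0 \<^bold>= Var 0"] derivable_num_N
    by simp
  with assms(1) have "derivable (\<Gamma> \<turnstile> c \<^bold>= c')"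
    by (rule derivable_conv_eq)
  then show ?thesis
    using assms(2) by (rule derivable_eq_trans) simp
qed

text \<open>What a head evaluation of \<open>t\<close> to a head \<open>t'\<close> means in the calculus. Heads such as abstractions
  are not natural numbers, so \<open>t \<^bold>= t'\<close> is not derivable in general; all that can be transferred are
  values of the terms obtained by further application.\<close>

definition reduces_to :: "trm \<Rightarrow> trm \<Rightarrow> bool" where
  "reduces_to t t' \<longleftrightarrow> (\<forall>us r. (\<forall>u \<in> set us. well_formed u) \<longrightarrow>
     derivable ({||} \<turnstile> foldl tApp t' us \<^bold>= num r) \<longrightarrow> derivable ({||} \<turnstile> foldl tApp t us \<^bold>= num r))"

lemma reduces_toD:
  "reduces_to t t' \<Longrightarrow> derivable ({||} \<turnstile> t' \<^bold>= num r) \<Longrightarrow> derivable ({||} \<turnstile> t \<^bold>= num r)"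
  unfolding reduces_to_def by (metis empty_iff foldl_Nil list.set(1))

lemma reduces_to_refl: "reduces_to t t"
  by (simp add: reduces_to_def)

lemma reduces_to_trans: "reduces_to t u \<Longrightarrow> reduces_to u v \<Longrightarrow> reduces_to t v"
  by (simp add: reduces_to_def)

lemma reduces_to_app: 
  assumes "reduces_to t t'" and "well_formed u"
  shows "reduces_to (t \<cdot> u) (t' \<cdot> u)"
  unfolding reduces_to_def
proof (intro allI impI)
  fix us r
  assume "\<forall>u \<in> set us. well_formed u" "derivable ({||} \<turnstile> foldl tApp (t' \<cdot> u) us \<^bold>= num r)"
  then show "derivable ({||} \<turnstile> foldl tApp (t \<cdot> u) us \<^bold>= num r)"
    using assms unfolding reduces_to_def by (auto dest!: spec[of _ "u # us"])
qed

lemma head_step_spine: "t \<triangleright> t' \<Longrightarrow> foldl tApp t us \<triangleright> foldl tApp t' us"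
  by (induction us arbitrary: t t') (auto intro: step_app)

lemma reduces_to_step: "t \<triangleright> t' \<Longrightarrow> reduces_to t t'"
  by (auto simp: reduces_to_def intro: derivable_step head_step_spine)

lemma reduces_to_argument:
  assumes "derivable ({||} \<turnstile> m \<^bold>= num k)" and "well_formed t"
  shows "reduces_to (t \<cdot> m) (t \<cdot> num k)"
  unfolding reduces_to_def
proof (intro allI impI)
  fix us r
  assume us: "\<forall>u \<in> set us. well_formed u"
    and der: "derivable ({||} \<turnstile> foldl tApp (t \<cdot> num k) us \<^bold>= num r)"
  have beta: "beta (foldl tApp t (map up us)) s = foldl tApp (beta t s) us" for s t
    by (induction us arbitrary: t) (auto simp: beta_up)
  have "well_formed (foldl tApp t (map up us)) = well_formed t" for t
    using us by (induction us arbitrary: t) auto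
  then show "derivable ({||} \<turnstile> foldl tApp (t \<cdot> m) us \<^bold>= num r)"
    using derivable_replace_eq[OF assms(1), of "foldl tApp (\<up>t \<cdot> Var 0) (map up us)" r] der assms(2)
    by (simp add: beta beta_up)
qed

fun head_term :: "head \<Rightarrow> trm" where
  "head_term (HLam b) = tLam b"
| "head_term HRec = tRec"
| "head_term (HRec1 g) = tRec \<cdot> g"
| "head_term (HRec2 g h) = tRec \<cdot> g \<cdot> h"
| "head_term HAll = tAll"

lemma derivable_all:
  assumes "derivable ({|isN (Var 0)|} \<turnstile> \<up>u \<cdot> Var 0)"
  shows "derivable ({||} \<turnstile> tAll \<cdot> u)"
  by (rule derivable_all_I) (use assms in simp)

lemma reduces_to_rec0:
  assumes "reduces_to t (tRec \<cdot> g \<cdot> h)" and "derivable ({||} \<turnstile> m \<^bold>= num 0)"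
    and "well_formed g" and "well_formed h" and "well_formed m"
  shows "reduces_to (t \<cdot> m) g"
proof -
  have "reduces_to (t \<cdot> m) (tRec \<cdot> g \<cdot> h \<cdot> m)"
    using assms by (intro reduces_to_app)
  also have "reduces_to (tRec \<cdot> g \<cdot> h \<cdot> m) (tRec \<cdot> g \<cdot> h \<cdot> num 0)"
    using assms by (intro reduces_to_argument) auto
  finally (reduces_to_trans) show ?thesis
    using reduces_to_step[OF step_rec0[of h g]] assms(4) reduces_to_trans by fastforce
qed

lemma reduces_to_recS:
  assumes "reduces_to t (tRec \<cdot> g \<cdot> h)" and "derivable ({||} \<turnstile> m \<^bold>= num (k + 1))"
    and "well_formed g" and "well_formed h" and "well_formed m"
  shows "reduces_to (t \<cdot> m) (h \<cdot> num k \<cdot> (tRec \<cdot> g \<cdot> h \<cdot> num k))"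
proof -
  have "reduces_to (t \<cdot> m) (tRec \<cdot> g \<cdot> h \<cdot> m)"
    using assms by (intro reduces_to_app)
  also have "reduces_to (tRec \<cdot> g \<cdot> h \<cdot> m) (tRec \<cdot> g \<cdot> h \<cdot> num (k + 1))"
    using assms by (intro reduces_to_argument) auto
  finally (reduces_to_trans) show ?thesis
    using reduces_to_step[OF step_recS[of g h k]] assms(3) reduces_to_trans by fastforce
qed

lemma reduces_to_beta:
  assumes "reduces_to t (tLam b)" and "well_formed u"
  shows "reduces_to (t \<cdot> u) (beta b u)"
  using reduces_to_app[OF assms] reduces_to_step[OF step_beta[OF assms(2)]]
  by (rule reduces_to_trans)

text \<open>Evaluations can be replayed in the calculus. Well-formedness of heads is part of the induction
  because it is a side condition of the conversion rules.\<close>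

lemma eval_derivable:
  "code \<tturnstile> t \<Down>\<^bsub>s\<^esub> r \<Longrightarrow> well_formed t \<Longrightarrow> derivable ({||} \<turnstile> t \<^bold>= num r)"
  "code \<tturnstile> t \<Down>hd\<^bsub>s\<^esub> w \<Longrightarrow> well_formed t \<Longrightarrow>
    well_formed (head_term w) \<and> reduces_to t (head_term w)"
proof (induction rule: val_eval_head_eval.inducts)
  case (val_zero s)
  then show ?case
    using derivable_num_N[of _ 0] by simp
next
  case (val_suc a s n)
  then show ?case
    using derivable_replace_eq[of "{||}" a "num n" "tSuc (Var 0)" "n + 1"]
      derivable_num_N[of _ "n + 1"]
    by simp
next
  case (val_eq a s m b n)
  then have a: "derivable ({||} \<turnstile> a \<^bold>= num m)" and b: "derivable ({||} \<turnstile> b \<^bold>= num n)"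
    by simp_all
  show ?case
  proof (cases "m = n")
    case True
    then have "derivable ({||} \<turnstile> a \<^bold>= b)"
      using derivable_eq_trans[OF a, of b] derivable_eq_sym[OF b] val_eq.prems by simp
    then show ?thesis
      using True derivable_true_I by simp
  next
    case False
    have "derivable ({||} \<turnstile> a \<^bold>\<noteq> num n)"
      using derivable_replace[OF derivable_eq_sym[OF a], of "Var 0 \<^bold>\<noteq> num n"]
        derivable_num_neq[OF False, of "{||}"] by (simp add: beta_eq_ssub)
    then have "derivable ({||} \<turnstile> a \<^bold>\<noteq> b)"
      using derivable_replace[OF derivable_eq_sym[OF b], of "\<up>a \<^bold>\<noteq> Var 0"] val_eq.prems
      by (simp add: beta_up)
    then show ?thesis
      using False derivable_false_I by simp
  qed
next
  case (val_not_ff a s)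
  then show ?case
    by (auto intro!: derivable_true_I dest: derivable_false_E)
next
  case (val_not_tt a s)
  then show ?case
    by (auto intro!: derivable_false_I derivable_notnot_I dest: derivable_true_E)
next
  case (val_or_tt a s b)
  then show ?case
    by (auto intro!: derivable_true_I dest: derivable_true_E intro: derivable_or_I1 derivable_or_I2)
next
  case (val_or_ff a s b)
  then show ?case
    by (auto intro!: derivable_false_I derivable_not_or_I dest: derivable_false_E)
next
  case (val_beta t s b u r)
  then have "reduces_to (t \<cdot> u) (beta b u)"
    by (intro reduces_to_beta) auto
  then show ?case
    using val_beta reduces_toD by (simp add: well_formed_beta)
next
  case (val_rec0 t s g h m r)
  then show ?case
    using reduces_toD[OF reduces_to_rec0[of t g h m], of r] by simp
next
  case (val_recS t s g h m k r)
  then show ?case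
    using reduces_toD[OF reduces_to_recS[of t g h m k], of r] by simp
next
  case (val_all_tt t s P u)
  then have "derivable ({||} \<turnstile> tAll \<cdot> u)"
    by (intro derivable_all) (auto simp: derivable_def)
  then show ?case
    using reduces_toD[OF reduces_to_app[of t tAll u], of 1] derivable_true_I val_all_tt by simp
next
  case (val_all_ff t s P u i)
  then have "derivable ({||} \<turnstile> \<^bold>\<not> (u \<cdot> num i))"
    by (auto simp: derivable_def)
  then have "derivable ({||} \<turnstile> \<^bold>\<not> (tAll \<cdot> u))"
    using derivable_not_all_I derivable_num_N by blast
  then show ?case
    using reduces_toD[OF reduces_to_app[of t tAll u], of 0] derivable_false_I val_all_ff by simp
next
  case (hd_rec1 t s g)
  then show ?case
    by (simp add: reduces_to_app)
next
  case (hd_rec2 t s g h)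
  then show ?case
    by (simp add: reduces_to_app)
next
  case (hd_beta t s b u w)
  then have "reduces_to (t \<cdot> u) (beta b u)"
    by (intro reduces_to_beta) auto
  then show ?case
    using hd_beta reduces_to_trans by (auto simp: well_formed_beta)
next
  case (hd_rec0 t s g h m w)
  then show ?case
    using reduces_to_trans[OF reduces_to_rec0[of t g h m]] by simp
next
  case (hd_recS t s g h m k w)
  then show ?case
    using reduces_to_trans[OF reduces_to_recS[of t g h m k]] by simp
qed (simp_all add: reduces_to_refl)

section \<open>Slash evaluation\<close>

text \<open>Evaluation without stages, and with the slash clauses for the quantifier. The derivability
  premise of \<open>slash_all_tt\<close> is about \<open>tAll \<cdot> u\<close> instead of the generic instance of \<open>u\<close>; for
  well-formed \<open>u\<close> both are equivalent, but this form needs no lifting, so that replacing equals in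
  \<open>u\<close> preserves it directly.\<close>

inductive slash_val :: "trm \<Rightarrow> nat \<Rightarrow> bool" and slash_head :: "trm \<Rightarrow> head \<Rightarrow> bool" where
  slash_zero: "slash_val tZero 0"
| slash_suc: "slash_val a n \<Longrightarrow> slash_val (tSuc a) (Suc n)"
| slash_eq: "slash_val a m \<Longrightarrow> slash_val b n \<Longrightarrow> slash_val (a \<^bold>= b) (if m = n then tt else ff)"
| slash_not_ff: "slash_val a ff \<Longrightarrow> slash_val (\<^bold>\<not> a) tt"
| slash_not_tt: "slash_val a tt \<Longrightarrow> slash_val (\<^bold>\<not> a) ff"
| slash_or_tt1: "slash_val a tt \<Longrightarrow> slash_val (a \<^bold>\<or> b) tt"
| slash_or_tt2: "slash_val b tt \<Longrightarrow> slash_val (a \<^bold>\<or> b) tt"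
| slash_or_ff: "slash_val a ff \<Longrightarrow> slash_val b ff \<Longrightarrow> slash_val (a \<^bold>\<or> b) ff"
| slash_beta: "slash_head t (HLam b) \<Longrightarrow> slash_val (beta b u) r \<Longrightarrow> slash_val (t \<cdot> u) r"
| slash_rec0: "slash_head t (HRec2 g h) \<Longrightarrow> slash_val m 0 \<Longrightarrow> slash_val g r \<Longrightarrow> slash_val (t \<cdot> m) r"
| slash_recS: "slash_head t (HRec2 g h) \<Longrightarrow> slash_val m (Suc k) \<Longrightarrow>
    slash_val (h \<cdot> num k \<cdot> (tRec \<cdot> g \<cdot> h \<cdot> num k)) r \<Longrightarrow> slash_val (t \<cdot> m) r"
| slash_all_tt: "slash_head t HAll \<Longrightarrow> derivable ({||} \<turnstile> tAll \<cdot> u) \<Longrightarrow>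
    (\<And>i. slash_val (u \<cdot> num i) tt) \<Longrightarrow> slash_val (t \<cdot> u) tt"
| slash_all_ff: "slash_head t HAll \<Longrightarrow> slash_val (u \<cdot> num i) ff \<Longrightarrow> slash_val (t \<cdot> u) ff"
| slash_hd_lam: "slash_head (tLam b) (HLam b)"
| slash_hd_rec: "slash_head tRec HRec"
| slash_hd_all: "slash_head tAll HAll"
| slash_hd_rec1: "slash_head t HRec \<Longrightarrow> slash_head (t \<cdot> g) (HRec1 g)"
| slash_hd_rec2: "slash_head t (HRec1 g) \<Longrightarrow> slash_head (t \<cdot> h) (HRec2 g h)"
| slash_hd_beta: "slash_head t (HLam b) \<Longrightarrow> slash_head (beta b u) w \<Longrightarrow> slash_head (t \<cdot> u) w"
| slash_hd_rec0: "slash_head t (HRec2 g h) \<Longrightarrow> slash_val m 0 \<Longrightarrow> slash_head g w \<Longrightarrow>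
    slash_head (t \<cdot> m) w"
| slash_hd_recS: "slash_head t (HRec2 g h) \<Longrightarrow> slash_val m (Suc k) \<Longrightarrow>
    slash_head (h \<cdot> num k \<cdot> (tRec \<cdot> g \<cdot> h \<cdot> num k)) w \<Longrightarrow> slash_head (t \<cdot> m) w"

inductive_cases slash_valE:
  "slash_val (Var i) r" "slash_val tBot r" "slash_val tZero r" "slash_val (tSuc a) r"
  "slash_val (a \<^bold>= b) r" "slash_val (\<^bold>\<not> a) r" "slash_val (a \<^bold>\<or> b) r"
  "slash_val (tLam b) r" "slash_val tRec r" "slash_val tAll r"
inductive_cases slash_val_appE: "slash_val (t \<cdot> u) r"
inductive_cases slash_headE:
  "slash_head (Var i) w" "slash_head tZero w" "slash_head (tSuc a) w" "slash_head (a \<^bold>= b) w"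
  "slash_head (\<^bold>\<not> a) w" "slash_head (a \<^bold>\<or> b) w" "slash_head (tLam b) w"
  "slash_head tRec w" "slash_head tAll w"
inductive_cases slash_head_appE: "slash_head (t \<cdot> u) w"

lemma slash_val_simps [simp]:
  "\<not> slash_val (Var i) r"
  "\<not> slash_val tBot r"
  "slash_val tZero r \<longleftrightarrow> r = 0"
  "slash_val (tSuc a) r \<longleftrightarrow> (\<exists>n. r = Suc n \<and> slash_val a n)"
  "slash_val (a \<^bold>= b) r \<longleftrightarrow> (\<exists>m n. slash_val a m \<and> slash_val b n \<and> r = (if m = n then tt else ff))"
  "slash_val (\<^bold>\<not> a) r \<longleftrightarrow> r = tt \<and> slash_val a ff \<or> r = ff \<and> slash_val a tt"
  "slash_val (a \<^bold>\<or> b) r \<longleftrightarrow>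
    r = tt \<and> (slash_val a tt \<or> slash_val b tt) \<or> r = ff \<and> slash_val a ff \<and> slash_val b ff"
  "\<not> slash_val (tLam b) r"
  "\<not> slash_val tRec r"
  "\<not> slash_val tAll r"
  by (blast elim: slash_valE intro: slash_val_slash_head.intros(1-8))+

lemma slash_val_eq_iff [simp]:
  "slash_val (a \<^bold>= b) tt \<longleftrightarrow> (\<exists>n. slash_val a n \<and> slash_val b n)"
  "slash_val (a \<^bold>= b) ff \<longleftrightarrow> (\<exists>m n. slash_val a m \<and> slash_val b n \<and> m \<noteq> n)"
  by (simp_all only: slash_val_simps) (metis zero_neq_one)+

declare slash_val_simps(5) [simp del]

lemma slash_head_simps [simp]:
  "\<not> slash_head (Var i) w" "\<not> slash_head tZero w" "\<not> slash_head (tSuc a) w"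
  "\<not> slash_head (a \<^bold>= b) w" "\<not> slash_head (\<^bold>\<not> a) w" "\<not> slash_head (a \<^bold>\<or> b) w"
  "slash_head (tLam b) w \<longleftrightarrow> w = HLam b"
  "slash_head tRec w \<longleftrightarrow> w = HRec"
  "slash_head tAll w \<longleftrightarrow> w = HAll"
  by (blast elim: slash_headE intro: slash_val_slash_head.intros)+

lemma slash_val_num: "slash_val (num n) n"
  by (induction n) auto

text \<open>No term has two values, two heads, or both a value and a head. The quantifier causes no
  conflict since a true universal statement has only true instances.\<close>

lemma slash_unique:
  "slash_val t r \<Longrightarrow> (\<forall>r'. slash_val t r' \<longrightarrow> r' = r) \<and> (\<forall>w. \<not> slash_head t w)"
  "slash_head t w \<Longrightarrow> \<forall>w'. slash_head t w' \<longrightarrow> w' = w"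
proof (induction rule: slash_val_slash_head.inducts)
  case (slash_beta t b u r)
  have head: "slash_head t w' \<longleftrightarrow> w' = HLam b" for w'
    using slash_beta.hyps(1) slash_beta.IH(1) by blast
  have unique: "slash_val (beta b u) x \<Longrightarrow> x = r" for x
    using slash_beta.IH(2) by blast+
  have no_head: "\<not> slash_head (beta b u) x" for x
    using slash_beta.IH(2) by blast
  show ?case
    by (intro conjI allI impI notI; erule slash_val_appE slash_head_appE)
      (auto simp: head no_head dest: unique)
next
  case (slash_rec0 t g h m r)
  have head: "slash_head t w' \<longleftrightarrow> w' = HRec2 g h" for w'
    using slash_rec0.hyps(1) slash_rec0.IH(1) by blast
  have unique: "slash_val m x \<Longrightarrow> x = 0" "slash_val g x \<Longrightarrow> x = r" for x
    using slash_rec0.IH(2) slash_rec0.IH(3) by blast+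
  have no_head: "\<not> slash_head g x" for x
    using slash_rec0.IH(3) by blast
  show ?case
    by (intro conjI allI impI notI; erule slash_val_appE slash_head_appE)
      (auto simp: head no_head dest: unique)
next
  case (slash_recS t g h m k r)
  have head: "slash_head t w' \<longleftrightarrow> w' = HRec2 g h" for w'
    using slash_recS.hyps(1) slash_recS.IH(1) by blast
  have unique: "slash_val m x \<Longrightarrow> x = Suc k"
    "slash_val (h \<cdot> num k \<cdot> (tRec \<cdot> g \<cdot> h \<cdot> num k)) x \<Longrightarrow> x = r" for x
    using slash_recS.IH(2) slash_recS.IH(3) by blast+
  have no_head: "\<not> slash_head (h \<cdot> num k \<cdot> (tRec \<cdot> g \<cdot> h \<cdot> num k)) x" for x
    using slash_recS.IH(3) by blast
  show ?case
    by (intro conjI allI impI notI; erule slash_val_appE slash_head_appE)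
      (auto simp: head no_head dest: unique)
next
  case (slash_all_tt t u)
  have head: "slash_head t w' \<longleftrightarrow> w' = HAll" for w'
    using slash_all_tt.hyps(1) slash_all_tt.IH(1) by blast
  have unique: "\<not> slash_val (u \<cdot> num i) ff" for i
    using slash_all_tt.IH(2)[of i] by auto
  show ?case
    by (intro conjI allI impI notI; erule slash_val_appE slash_head_appE)
      (auto simp: head unique)
next
  case (slash_all_ff t u i)
  have head: "slash_head t w' \<longleftrightarrow> w' = HAll" for w'
    using slash_all_ff.hyps(1) slash_all_ff.IH(1) by blast
  have "\<not> slash_val (u \<cdot> num i) tt"
    using slash_all_ff.IH(2) by auto
  show ?case
    by (intro conjI allI impI notI; erule slash_val_appE slash_head_appE)
      (use \<open>\<not> slash_val (u \<cdot> num i) tt\<close> in \<open>auto simp: head\<close>)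
next
  case (slash_hd_rec1 t g)
  have head: "slash_head t w' \<longleftrightarrow> w' = HRec" for w'
    using slash_hd_rec1.hyps(1) slash_hd_rec1.IH(1) by blast
  show ?case
    by (intro allI impI; erule slash_head_appE) (auto simp: head)
next
  case (slash_hd_rec2 t g h)
  have head: "slash_head t w' \<longleftrightarrow> w' = HRec1 g" for w'
    using slash_hd_rec2.hyps(1) slash_hd_rec2.IH(1) by blast
  show ?case
    by (intro allI impI; erule slash_head_appE) (auto simp: head)
next
  case (slash_hd_beta t b u w)
  have head: "slash_head t w' \<longleftrightarrow> w' = HLam b" for w'
    using slash_hd_beta.hyps(1) slash_hd_beta.IH(1) by blast
  have unique: "slash_head (beta b u) x \<Longrightarrow> x = w" for x
    using slash_hd_beta.IH(2) by blast+
  show ?case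
    by (intro allI impI; erule slash_head_appE) (auto simp: head dest: unique)
next
  case (slash_hd_rec0 t g h m w)
  have head: "slash_head t w' \<longleftrightarrow> w' = HRec2 g h" for w'
    using slash_hd_rec0.hyps(1) slash_hd_rec0.IH(1) by blast
  have unique: "slash_val m x \<Longrightarrow> x = 0" "slash_head g y \<Longrightarrow> y = w" for x y
    using slash_hd_rec0.IH(2) slash_hd_rec0.IH(3) by blast+
  show ?case
    by (intro allI impI; erule slash_head_appE) (auto simp: head dest: unique)
next
  case (slash_hd_recS t g h m k w)
  have head: "slash_head t w' \<longleftrightarrow> w' = HRec2 g h" for w'
    using slash_hd_recS.hyps(1) slash_hd_recS.IH(1) by blast
  have arg: "slash_val m x \<longleftrightarrow> x = Suc k" for x
    using slash_hd_recS.hyps(2) slash_hd_recS.IH(2) by blast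
  show ?case
  proof (intro allI impI)
    fix w' assume "slash_head (t \<cdot> m) w'"
    then have "slash_head (h \<cdot> num k \<cdot> (tRec \<cdot> g \<cdot> h \<cdot> num k)) w'"
      by (rule slash_head_appE) (simp_all add: head arg)
    then show "w' = w"
      using slash_hd_recS.IH(3) by blast
  qed
qed ((simp (no_asm) only: slash_val_simps slash_head_simps; metis zero_neq_one)+)

lemma slash_val_unique: "slash_val t r \<Longrightarrow> slash_val t r' \<Longrightarrow> r' = r"
  using slash_unique(1) by blast

lemma slash_val_num_iff [simp]: "slash_val (num n) r \<longleftrightarrow> r = n"
  using slash_val_num slash_val_unique by blast

lemma slash_val_not_head: "slash_val t r \<Longrightarrow> \<not> slash_head t w"
  using slash_unique(1) by blast

section \<open>Slash evaluation is contained in evaluation\<close>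

lemma eval_Suc_stage:
  "code \<tturnstile> t \<Down>\<^bsub>s\<^esub> r \<Longrightarrow> code \<tturnstile> t \<Down>\<^bsub>s + 1\<^esub> r"
  "code \<tturnstile> t \<Down>hd\<^bsub>s\<^esub> w \<Longrightarrow> code \<tturnstile> t \<Down>hd\<^bsub>s + 1\<^esub> w"
proof (induction rule: val_eval_head_eval.inducts)
  case (val_or_tt a s b)
  then show ?case using val_eval_head_eval.val_or_tt by blast
next
  case (val_all_tt t s P u)
  then show ?case using val_eval_head_eval.val_all_tt[of code t "s + 1" P u] by simp
next
  case (val_all_ff t s P u i)
  then show ?case using val_eval_head_eval.val_all_ff[of code t "s + 1" P u i] by simp
qed (blast intro: val_eval_head_eval.intros)+

lemma eval_mono:
  assumes "s \<le> s'"
  shows "code \<tturnstile> t \<Down>\<^bsub>s\<^esub> r \<Longrightarrow> code \<tturnstile> t \<Down>\<^bsub>s'\<^esub> r"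
    and "code \<tturnstile> t \<Down>hd\<^bsub>s\<^esub> w \<Longrightarrow> code \<tturnstile> t \<Down>hd\<^bsub>s'\<^esub> w"
  using assms by (induction s' rule: dec_induct) (auto dest: eval_Suc_stage[folded Suc_eq_plus1])

text \<open>The converse of the introduction rule: lift the universal statement and apply it to the new
  variable.\<close>

lemma derivable_generic_instance:
  assumes "derivable ({||} \<turnstile> tAll \<cdot> u)" and "well_formed u"
  shows "derivable ({|isN (Var 0)|} \<turnstile> \<up>u \<cdot> Var 0)"
proof -
  have "derivable ({||} \<turnstile> tAll \<cdot> \<up>u)"
    using derivable_ssub[OF assms(1), of "\<lambda>i. Var (i + 1)"] assms(2) by (simp add: up_eq_ssub)
  then have "derivable ({|isN (Var 0)|} \<turnstile> tAll \<cdot> \<up>u)"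
    by (rule derivable_weaken)
  then show ?thesis
    by (rule derivable_all_E) (simp add: derivable_hyp)
qed

text \<open>A false universal statement has a false instance; its refutation, which evaluation demands as
  evidence, comes from replaying the evaluation of that instance.\<close>

lemma slash_eval:
  "slash_val t r \<Longrightarrow> well_formed t \<Longrightarrow> \<exists>s. code \<tturnstile> t \<Down>\<^bsub>s\<^esub> r"
  "slash_head t w \<Longrightarrow> well_formed t \<Longrightarrow> \<exists>s. code \<tturnstile> t \<Down>hd\<^bsub>s\<^esub> w"
proof (induction rule: slash_val_slash_head.inducts)
  case slash_zero
  show ?case using val_zero[of code 0] by blast
next
  case (slash_suc a n)
  then obtain s where "code \<tturnstile> a \<Down>\<^bsub>s\<^esub> n" by auto
  then show ?case using val_suc[of code a s n] by (auto simp flip: Suc_eq_plus1)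
next
  case (slash_eq a m b n)
  then obtain s s' where "code \<tturnstile> a \<Down>\<^bsub>s\<^esub> m" "code \<tturnstile> b \<Down>\<^bsub>s'\<^esub> n" by auto
  then have "code \<tturnstile> a \<Down>\<^bsub>max s s'\<^esub> m" "code \<tturnstile> b \<Down>\<^bsub>max s s'\<^esub> n"
    by (auto intro: eval_mono(1)[rotated])
  then show ?case by (blast intro: val_eq)
next
  case (slash_not_ff a)
  then show ?case by (auto intro: val_not_ff)
next
  case (slash_not_tt a)
  then show ?case by (auto intro: val_not_tt)
next
  case (slash_or_tt1 a b)
  then show ?case by (auto intro: val_or_tt)
next
  case (slash_or_tt2 b a)
  then show ?case by (auto intro: val_or_tt)
next
  case (slash_or_ff a b)
  then obtain s s' where "code \<tturnstile> a \<Down>\<^bsub>s\<^esub> ff" "code \<tturnstile> b \<Down>\<^bsub>s'\<^esub> ff" by auto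
  then have "code \<tturnstile> a \<Down>\<^bsub>max s s'\<^esub> ff" "code \<tturnstile> b \<Down>\<^bsub>max s s'\<^esub> ff"
    by (auto intro: eval_mono(1)[rotated])
  then show ?case by (blast intro: val_or_ff)
next
  case (slash_beta t b u r)
  then obtain s where s: "code \<tturnstile> t \<Down>hd\<^bsub>s\<^esub> HLam b" by auto
  then have "well_formed b"
    using eval_derivable(2)[OF s] slash_beta.prems by simp
  then obtain s' where s': "code \<tturnstile> beta b u \<Down>\<^bsub>s'\<^esub> r"
    using slash_beta by (auto simp: well_formed_beta)
  show ?case
    using val_beta[of code t "max s s'" b u r] eval_mono(2)[OF _ s] eval_mono(1)[OF _ s'] by auto
next
  case (slash_rec0 t g h m r)
  then obtain s s' where s: "code \<tturnstile> t \<Down>hd\<^bsub>s\<^esub> HRec2 g h" and s': "code \<tturnstile> m \<Down>\<^bsub>s'\<^esub> 0" by auto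
  then obtain s'' where s'': "code \<tturnstile> g \<Down>\<^bsub>s''\<^esub> r"
    using eval_derivable(2)[OF s] slash_rec0 by auto
  show ?case
    using val_rec0[of code t "max s (max s' s'')" g h m r]
      eval_mono(2)[OF _ s] eval_mono(1)[OF _ s'] eval_mono(1)[OF _ s''] by auto
next
  case (slash_recS t g h m k r)
  then obtain s s' where s: "code \<tturnstile> t \<Down>hd\<^bsub>s\<^esub> HRec2 g h" and s': "code \<tturnstile> m \<Down>\<^bsub>s'\<^esub> k + 1"
    by (auto simp flip: Suc_eq_plus1)
  then obtain s'' where s'': "code \<tturnstile> h \<cdot> num k \<cdot> (tRec \<cdot> g \<cdot> h \<cdot> num k) \<Down>\<^bsub>s''\<^esub> r"
    using eval_derivable(2)[OF s] slash_recS by auto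
  show ?case
    using val_recS[of code t "max s (max s' s'')" g h m k r]
      eval_mono(2)[OF _ s] eval_mono(1)[OF _ s'] eval_mono(1)[OF _ s''] by auto
next
  case (slash_all_tt t u)
  then obtain s where s: "code \<tturnstile> t \<Down>hd\<^bsub>s\<^esub> HAll" by auto
  obtain P where P: "P \<rhd> ({|isN (Var 0)|} \<turnstile> \<up>u \<cdot> Var 0)"
    using derivable_generic_instance[of u] slash_all_tt by (auto simp: derivable_def)
  show ?case
    using val_all_tt[of code t "max s (code P)" P u] eval_mono(2)[OF _ s] P by auto
next
  case (slash_all_ff t u i)
  then obtain s s' where s: "code \<tturnstile> t \<Down>hd\<^bsub>s\<^esub> HAll" and s': "code \<tturnstile> u \<cdot> num i \<Down>\<^bsub>s'\<^esub> ff" by auto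
  have "derivable ({||} \<turnstile> \<^bold>\<not> (u \<cdot> num i))"
    using eval_derivable(1)[OF s'] slash_all_ff.prems by (auto intro: derivable_false_E)
  then obtain P where P: "P \<rhd> ({||} \<turnstile> \<^bold>\<not> (u \<cdot> num i))"
    by (auto simp: derivable_def)
  show ?case
    using val_all_ff[of code t "max s (code P)" P u i] eval_mono(2)[OF _ s] P by auto
next
  case (slash_hd_lam b)
  show ?case using hd_lam by blast
next
  case slash_hd_rec
  show ?case using hd_rec by blast
next
  case slash_hd_all
  show ?case using hd_all by blast
next
  case (slash_hd_rec1 t g)
  then show ?case by (auto intro: hd_rec1)
next
  case (slash_hd_rec2 t g h)
  then show ?case by (auto intro: hd_rec2)
next
  case (slash_hd_beta t b u w)
  then obtain s where s: "code \<tturnstile> t \<Down>hd\<^bsub>s\<^esub> HLam b" by auto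
  then have "well_formed b"
    using eval_derivable(2)[OF s] slash_hd_beta.prems by simp
  then obtain s' where s': "code \<tturnstile> beta b u \<Down>hd\<^bsub>s'\<^esub> w"
    using slash_hd_beta by (auto simp: well_formed_beta)
  show ?case
    using hd_beta[of code t "max s s'" b u w] eval_mono(2)[OF _ s] eval_mono(2)[OF _ s'] by auto
next
  case (slash_hd_rec0 t g h m w)
  then obtain s s' where s: "code \<tturnstile> t \<Down>hd\<^bsub>s\<^esub> HRec2 g h" and s': "code \<tturnstile> m \<Down>\<^bsub>s'\<^esub> 0" by auto
  then obtain s'' where s'': "code \<tturnstile> g \<Down>hd\<^bsub>s''\<^esub> w"
    using eval_derivable(2)[OF s] slash_hd_rec0 by auto
  show ?case
    using hd_rec0[of code t "max s (max s' s'')" g h m w]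
      eval_mono(2)[OF _ s] eval_mono(1)[OF _ s'] eval_mono(2)[OF _ s''] by auto
next
  case (slash_hd_recS t g h m k w)
  then obtain s s' where s: "code \<tturnstile> t \<Down>hd\<^bsub>s\<^esub> HRec2 g h" and s': "code \<tturnstile> m \<Down>\<^bsub>s'\<^esub> k + 1"
    by (auto simp flip: Suc_eq_plus1)
  then obtain s'' where s'': "code \<tturnstile> h \<cdot> num k \<cdot> (tRec \<cdot> g \<cdot> h \<cdot> num k) \<Down>hd\<^bsub>s''\<^esub> w"
    using eval_derivable(2)[OF s] slash_hd_recS by auto
  show ?case
    using hd_recS[of code t "max s (max s' s'')" g h m k w]
      eval_mono(2)[OF _ s] eval_mono(1)[OF _ s'] eval_mono(2)[OF _ s''] by auto
qed

lemma slash_derivable: "slash_val t r \<Longrightarrow> well_formed t \<Longrightarrow> derivable ({||} \<turnstile> t \<^bold>= num r)"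
  using slash_eval(1) eval_derivable(1) by blast

section \<open>Slash evaluation respects equality of values\<close>

fun head_ssub :: "(nat \<Rightarrow> trm) \<Rightarrow> head \<Rightarrow> head" where
  "head_ssub \<sigma> (HLam b) = HLam (ssub (shift 1 \<sigma>) b)"
| "head_ssub \<sigma> HRec = HRec"
| "head_ssub \<sigma> (HRec1 g) = HRec1 (ssub \<sigma> g)"
| "head_ssub \<sigma> (HRec2 g h) = HRec2 (ssub \<sigma> g) (ssub \<sigma> h)"
| "head_ssub \<sigma> HAll = HAll"

lemma head_ssub_eq:
  "head_ssub \<sigma> v = HLam b \<longleftrightarrow> (\<exists>q. v = HLam q \<and> b = ssub (shift 1 \<sigma>) q)"
  "head_ssub \<sigma> v = HRec \<longleftrightarrow> v = HRec"
  "head_ssub \<sigma> v = HRec1 g \<longleftrightarrow> (\<exists>q. v = HRec1 q \<and> g = ssub \<sigma> q)"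
  "head_ssub \<sigma> v = HRec2 g h \<longleftrightarrow> (\<exists>q q'. v = HRec2 q q' \<and> g = ssub \<sigma> q \<and> h = ssub \<sigma> q')"
  "head_ssub \<sigma> v = HAll \<longleftrightarrow> v = HAll"
  by (cases v; auto)+

context
  fixes a b :: trm and n :: nat
  assumes a: "slash_val a n" "well_formed a" and b: "slash_val b n" "well_formed b"
begin

private abbreviation "A \<equiv> case_nat a Var"
private abbreviation "B \<equiv> case_nat b Var"

private lemma derivable_eq: "derivable ({||} \<turnstile> a \<^bold>= b)"
  using derivable_eq_trans[OF slash_derivable[OF a] derivable_eq_sym[OF slash_derivable[OF b]]] b(2)
  by simp

private lemma val_cases:
  assumes "slash_val (Op f 0 ts) r" and "Op f 0 ts = ssub A p"
    and "\<And>ps. p = Op f 0 ps \<Longrightarrow> ts = map (ssub A) ps \<Longrightarrow> slash_val (ssub B (Op f 0 ps)) r"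
  shows "slash_val (ssub B p) r"
proof (cases p)
  case (Var i)
  then show ?thesis
    using assms a(1) b(1) by (auto split: nat.splits dest: slash_val_unique)
qed (use assms in auto)

private lemma val_app_cases:
  assumes "slash_val (t \<cdot> u) r" and "t \<cdot> u = ssub A p"
    and "\<And>p q. t = ssub A p \<Longrightarrow> u = ssub A q \<Longrightarrow> well_formed p \<Longrightarrow> well_formed q \<Longrightarrow>
      slash_val (ssub B (p \<cdot> q)) r"
    and "well_formed p"
  shows "slash_val (ssub B p) r"
  by (rule val_cases[OF assms(1,2)]) (use assms(3,4) in \<open>auto simp: Cons_eq_map_conv\<close>)

private lemma head_cases:
  assumes "slash_head (Op f k ts) w" and "Op f k ts = ssub A p"
  obtains ps where "p = Op f k ps" and "ts = map (ssub (shift k A)) ps"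
proof (cases p)
  case (Var i)
  then show ?thesis
    using assms slash_val_not_head[OF a(1)] by (auto split: nat.splits)
qed (use assms that in auto)

private lemma head_app_cases:
  assumes "slash_head (t \<cdot> u) w" and "t \<cdot> u = ssub A p" and "well_formed p"
  obtains p1 p2 where "p = p1 \<cdot> p2" and "t = ssub A p1" and "u = ssub A p2"
    and "well_formed p1" and "well_formed p2"
proof (rule head_cases[OF assms(1,2)])
  fix ps assume "p = Op 9 0 ps" and "[t, u] = map (ssub (shift 0 A)) ps"
  then show thesis
    using assms(3) by (auto simp: Cons_eq_map_conv intro!: that)
qed

text \<open>The induction follows the evaluation of a context \<open>p\<close> whose hole is filled with \<open>a\<close>. Either
  the context is the hole itself, and then values agree by assumption, while a head is impossible
  because \<open>a\<close> has a value; or the outermost operator belongs to the context. In the second case a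
  head is again a filled context (hence \<open>head_ssub\<close>), and so is each \<open>\<beta>\<close>-instance and each unfolding
  of the recursor, with the same \<open>a\<close> and \<open>b\<close>.\<close>

lemma slash_replace:
  "slash_val t r \<Longrightarrow> t = ssub A p \<Longrightarrow> well_formed p \<Longrightarrow> slash_val (ssub B p) r"
  "slash_head t w \<Longrightarrow> t = ssub A p \<Longrightarrow> well_formed p \<Longrightarrow>
    \<exists>v. head_ssub A v = w \<and> well_formed (head_term v) \<and> slash_head (ssub B p) (head_ssub B v)"
proof (induction arbitrary: p and p rule: slash_val_slash_head.inducts)
  case slash_zero
  show ?case
    by (rule val_cases[OF slash_val_slash_head.slash_zero slash_zero(1)]) auto
next
  case (slash_suc c k)
  show ?case
    by (rule val_cases[OF slash_val_slash_head.slash_suc[OF slash_suc.hyps] slash_suc.prems(1)])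
      (use slash_suc.IH slash_suc.prems(2) in auto)
next
  case (slash_eq c k d l)
  show ?case
  proof (rule val_cases[OF slash_val_slash_head.slash_eq[OF slash_eq.hyps] slash_eq.prems(1)])
    fix ps assume ps: "p = Op 7 0 ps" "[c, d] = map (ssub A) ps"
    then obtain p1 p2 where "ps = [p1, p2]"
      by (auto simp: Cons_eq_map_conv)
    then show "slash_val (ssub B (Op 7 0 ps)) (if k = l then tt else ff)"
      using ps slash_eq.IH(1)[of p1] slash_eq.IH(2)[of p2] slash_eq.prems(2)
        slash_val_slash_head.slash_eq[of "ssub B p1" k "ssub B p2" l] by simp
  qed
next
  case (slash_not_ff c)
  show ?case
    by (rule val_cases[OF slash_val_slash_head.slash_not_ff[OF slash_not_ff.hyps]
          slash_not_ff.prems(1)])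
      (use slash_not_ff.IH slash_not_ff.prems(2) in auto)
next
  case (slash_not_tt c)
  show ?case
    by (rule val_cases[OF slash_val_slash_head.slash_not_tt[OF slash_not_tt.hyps]
          slash_not_tt.prems(1)])
      (use slash_not_tt.IH slash_not_tt.prems(2) in auto)
next
  case (slash_or_tt1 c d)
  show ?case
    by (rule val_cases[OF slash_val_slash_head.slash_or_tt1[OF slash_or_tt1.hyps]
          slash_or_tt1.prems(1)])
      (use slash_or_tt1.IH slash_or_tt1.prems(2) in \<open>auto simp: Cons_eq_map_conv\<close>)
next
  case (slash_or_tt2 d c)
  show ?case
    by (rule val_cases[OF slash_val_slash_head.slash_or_tt2[OF slash_or_tt2.hyps]
          slash_or_tt2.prems(1)])
      (use slash_or_tt2.IH slash_or_tt2.prems(2) in \<open>auto simp: Cons_eq_map_conv\<close>)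
next
  case (slash_or_ff c d)
  show ?case
    by (rule val_cases[OF slash_val_slash_head.slash_or_ff[OF slash_or_ff.hyps]
          slash_or_ff.prems(1)])
      (use slash_or_ff.IH slash_or_ff.prems(2) in \<open>auto simp: Cons_eq_map_conv\<close>)
next
  case (slash_beta t c u r)
  show ?case
  proof (rule val_app_cases[OF _ slash_beta.prems(1) _ slash_beta.prems(2)])
    show "slash_val (t \<cdot> u) r"
      using slash_beta.hyps by (rule slash_val_slash_head.slash_beta)
    fix p1 p2 assume p: "t = ssub A p1" "u = ssub A p2" "well_formed p1" "well_formed p2"
    then obtain q where q: "c = ssub (shift 1 A) q" "well_formed q"
      "slash_head (ssub B p1) (HLam (ssub (shift 1 B) q))"
      using slash_beta.IH(1)[of p1] by (auto simp: head_ssub_eq)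
    then have "slash_val (ssub B (beta q p2)) r"
      using p slash_beta.IH(2)[of "beta q p2"] by (simp add: ssub_beta well_formed_beta)
    with q(3) show "slash_val (ssub B (p1 \<cdot> p2)) r"
      by (auto simp: ssub_beta intro: slash_val_slash_head.slash_beta)
  qed
next
  case (slash_rec0 t g h m r)
  show ?case
  proof (rule val_app_cases[OF _ slash_rec0.prems(1) _ slash_rec0.prems(2)])
    show "slash_val (t \<cdot> m) r"
      using slash_rec0.hyps by (rule slash_val_slash_head.slash_rec0)
    fix p1 p2 assume p: "t = ssub A p1" "m = ssub A p2" "well_formed p1" "well_formed p2"
    then obtain g' h' where q: "g = ssub A g'" "well_formed g'"
      "slash_head (ssub B p1) (HRec2 (ssub B g') (ssub B h'))"
      using slash_rec0.IH(1)[of p1] by (auto simp: head_ssub_eq)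
    with p show "slash_val (ssub B (p1 \<cdot> p2)) r"
      using slash_rec0.IH(2)[of p2] slash_rec0.IH(3)[of g']
        slash_val_slash_head.slash_rec0[OF q(3)] by simp
  qed
next
  case (slash_recS t g h m k r)
  show ?case
  proof (rule val_app_cases[OF _ slash_recS.prems(1) _ slash_recS.prems(2)])
    show "slash_val (t \<cdot> m) r"
      using slash_recS.hyps by (rule slash_val_slash_head.slash_recS)
    fix p1 p2 assume p: "t = ssub A p1" "m = ssub A p2" "well_formed p1" "well_formed p2"
    then obtain g' h' where q: "g = ssub A g'" "h = ssub A h'" "well_formed g'" "well_formed h'"
      "slash_head (ssub B p1) (HRec2 (ssub B g') (ssub B h'))"
      using slash_recS.IH(1)[of p1] by (auto simp: head_ssub_eq)
    then have "slash_val (ssub B (h' \<cdot> num k \<cdot> (tRec \<cdot> g' \<cdot> h' \<cdot> num k))) r"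
      by (intro slash_recS.IH(3)) auto
    with p show "slash_val (ssub B (p1 \<cdot> p2)) r"
      using slash_recS.IH(2)[of p2] slash_val_slash_head.slash_recS[OF q(5)] by simp
  qed
next
  case (slash_all_tt t u)
  show ?case
  proof (rule val_app_cases[OF _ slash_all_tt.prems(1) _ slash_all_tt.prems(2)])
    show "slash_val (t \<cdot> u) tt"
      using slash_all_tt.hyps by (rule slash_val_slash_head.slash_all_tt)
    fix p1 p2 assume p: "t = ssub A p1" "u = ssub A p2" "well_formed p1" "well_formed p2"
    have "slash_head (ssub B p1) HAll"
      using slash_all_tt.IH(1)[of p1] p by (auto simp: head_ssub_eq)
    moreover have "derivable ({||} \<turnstile> beta (tAll \<cdot> p2) b)"
      using slash_all_tt.hyps(2) p
      by (intro derivable_replace[OF derivable_eq]) (auto simp: beta_eq_ssub)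
    moreover have "slash_val (ssub B (p2 \<cdot> num i)) tt" for i
      using p by (intro slash_all_tt.IH(2)) auto
    ultimately show "slash_val (ssub B (p1 \<cdot> p2)) tt"
      by (auto simp: beta_eq_ssub intro: slash_val_slash_head.slash_all_tt)
  qed
next
  case (slash_all_ff t u i)
  show ?case
  proof (rule val_app_cases[OF _ slash_all_ff.prems(1) _ slash_all_ff.prems(2)])
    show "slash_val (t \<cdot> u) ff"
      using slash_all_ff.hyps by (rule slash_val_slash_head.slash_all_ff)
    fix p1 p2 assume p: "t = ssub A p1" "u = ssub A p2" "well_formed p1" "well_formed p2"
    have "slash_head (ssub B p1) HAll"
      using slash_all_ff.IH(1)[of p1] p by (auto simp: head_ssub_eq)
    moreover have "slash_val (ssub B (p2 \<cdot> num i)) ff"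
      using p by (intro slash_all_ff.IH(2)) auto
    ultimately show "slash_val (ssub B (p1 \<cdot> p2)) ff"
      by (auto intro: slash_val_slash_head.slash_all_ff)
  qed
next
  case (slash_hd_lam c)
  show ?case
    by (rule head_cases[OF slash_val_slash_head.slash_hd_lam slash_hd_lam.prems(1)])
      (use slash_hd_lam.prems(2) in \<open>auto simp: head_ssub_eq intro: slash_val_slash_head.intros\<close>)
next
  case slash_hd_rec
  show ?case
    by (rule head_cases[OF slash_val_slash_head.slash_hd_rec slash_hd_rec.prems(1)])
      (auto simp: head_ssub_eq)
next
  case slash_hd_all
  show ?case
    by (rule head_cases[OF slash_val_slash_head.slash_hd_all slash_hd_all.prems(1)])
      (auto simp: head_ssub_eq)
next
  case (slash_hd_rec1 t g)
  obtain p1 p2 where p: "p = p1 \<cdot> p2" "t = ssub A p1" "g = ssub A p2"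
    "well_formed p1" "well_formed p2"
    using head_app_cases[OF slash_val_slash_head.slash_hd_rec1[OF slash_hd_rec1.hyps]
        slash_hd_rec1.prems] .
  then have "slash_head (ssub B p1) HRec"
    using slash_hd_rec1.IH[of p1] by (auto simp: head_ssub_eq)
  then have "slash_head (ssub B p) (HRec1 (ssub B p2))"
    using slash_val_slash_head.slash_hd_rec1 by (simp add: p)
  then show ?case
    using p by (intro exI[of _ "HRec1 p2"]) simp
next
  case (slash_hd_rec2 t g h)
  obtain p1 p2 where p: "p = p1 \<cdot> p2" "t = ssub A p1" "h = ssub A p2"
    "well_formed p1" "well_formed p2"
    using head_app_cases[OF slash_val_slash_head.slash_hd_rec2[OF slash_hd_rec2.hyps]
        slash_hd_rec2.prems] .
  then obtain g' where q: "g = ssub A g'" "well_formed g'"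
    "slash_head (ssub B p1) (HRec1 (ssub B g'))"
    using slash_hd_rec2.IH[of p1] by (auto simp: head_ssub_eq)
  then have "slash_head (ssub B p) (HRec2 (ssub B g') (ssub B p2))"
    using slash_val_slash_head.slash_hd_rec2 by (simp add: p)
  then show ?case
    using p q by (intro exI[of _ "HRec2 g' p2"]) simp
next
  case (slash_hd_beta t c u w)
  obtain p1 p2 where p: "p = p1 \<cdot> p2" "t = ssub A p1" "u = ssub A p2"
    "well_formed p1" "well_formed p2"
    using head_app_cases[OF slash_val_slash_head.slash_hd_beta[OF slash_hd_beta.hyps]
        slash_hd_beta.prems] .
  then obtain q where q: "c = ssub (shift 1 A) q" "well_formed q"
    "slash_head (ssub B p1) (HLam (ssub (shift 1 B) q))"
    using slash_hd_beta.IH(1)[of p1] by (auto simp: head_ssub_eq)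
  show ?case
    using p q slash_hd_beta.IH(2)[of "beta q p2"] slash_val_slash_head.slash_hd_beta[OF q(3)]
    by (auto simp: ssub_beta well_formed_beta)
next
  case (slash_hd_rec0 t g h m w)
  obtain p1 p2 where p: "p = p1 \<cdot> p2" "t = ssub A p1" "m = ssub A p2"
    "well_formed p1" "well_formed p2"
    using head_app_cases[OF slash_val_slash_head.slash_hd_rec0[OF slash_hd_rec0.hyps]
        slash_hd_rec0.prems] .
  then obtain g' h' where q: "g = ssub A g'" "well_formed g'"
    "slash_head (ssub B p1) (HRec2 (ssub B g') (ssub B h'))"
    using slash_hd_rec0.IH(1)[of p1] by (auto simp: head_ssub_eq)
  show ?case
    using p q slash_hd_rec0.IH(2)[of p2] slash_hd_rec0.IH(3)[of g']
      slash_val_slash_head.slash_hd_rec0[OF q(3)]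
    by auto
next
  case (slash_hd_recS t g h m k w)
  obtain p1 p2 where p: "p = p1 \<cdot> p2" "t = ssub A p1" "m = ssub A p2"
    "well_formed p1" "well_formed p2"
    using head_app_cases[OF slash_val_slash_head.slash_hd_recS[OF slash_hd_recS.hyps]
        slash_hd_recS.prems] .
  then obtain g' h' where q: "g = ssub A g'" "h = ssub A h'" "well_formed g'" "well_formed h'"
    "slash_head (ssub B p1) (HRec2 (ssub B g') (ssub B h'))"
    using slash_hd_recS.IH(1)[of p1] by (auto simp: head_ssub_eq)
  show ?case
    using p q slash_hd_recS.IH(2)[of p2]
      slash_hd_recS.IH(3)[of "h' \<cdot> num k \<cdot> (tRec \<cdot> g' \<cdot> h' \<cdot> num k)"]
      slash_val_slash_head.slash_hd_recS[OF q(5)]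
    by auto
qed

end

lemma slash_replace_value:
  assumes "slash_val a n" and "slash_val b n" and "slash_val (beta p a) r"
    and "well_formed a" and "well_formed b" and "well_formed p"
  shows "slash_val (beta p b) r"
  using slash_replace(1)[of a n b "beta p a" r p] assms by (simp add: beta_eq_ssub)

section \<open>Slash evaluation is invariant under head steps\<close>

text \<open>The clauses for an application depend on its operator only through the head of the operator;
  this makes the invariance under head steps pass to applications.\<close>

lemma slash_app_cong:
  assumes "\<And>w. slash_head t w \<longleftrightarrow> slash_head t' w"
  shows "slash_val (t \<cdot> u) r \<longleftrightarrow> slash_val (t' \<cdot> u) r"
    and "slash_head (t \<cdot> u) w \<longleftrightarrow> slash_head (t' \<cdot> u) w"
  by (rule iffI; erule slash_val_appE;
      use assms in \<open>auto intro: slash_val_slash_head.intros(9-13)\<close>)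
    (rule iffI; erule slash_head_appE;
      use assms in \<open>auto intro: slash_val_slash_head.intros(17-21)\<close>)

lemma slash_head_rec: "slash_head (tRec \<cdot> g) w \<longleftrightarrow> w = HRec1 g"
  by (auto elim: slash_head_appE intro: slash_val_slash_head.intros)

lemma slash_head_rec2: "slash_head (tRec \<cdot> g \<cdot> h) w \<longleftrightarrow> w = HRec2 g h"
  by (auto elim: slash_head_appE simp: slash_head_rec intro: slash_val_slash_head.intros)

lemma slash_head_step:
  assumes "c \<triangleright> c'"
  shows "slash_val c r \<longleftrightarrow> slash_val c' r" and "slash_head c w \<longleftrightarrow> slash_head c' w"
proof -
  from assms have "(\<forall>r. slash_val c r \<longleftrightarrow> slash_val c' r) \<and> (\<forall>w. slash_head c w \<longleftrightarrow> slash_head c' w)"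
  proof induction
    case (step_beta t b)
    show ?case
      by (auto elim: slash_val_appE slash_head_appE
          intro: slash_val_slash_head.slash_beta slash_val_slash_head.slash_hd_beta)
  next
    case (step_rec0 h g)
    show ?case
      by (auto elim: slash_val_appE slash_head_appE simp: slash_head_rec2
          intro: slash_val_slash_head.slash_rec0 slash_val_slash_head.slash_hd_rec0)
  next
    case (step_recS g h n)
    have "slash_val (h \<cdot> num n \<cdot> (tRec \<cdot> g \<cdot> h \<cdot> num n)) r"
      if "slash_val (tRec \<cdot> g \<cdot> h \<cdot> tSuc (num n)) r" for r
      using that by (rule slash_val_appE) (auto simp: slash_head_rec2)
    moreover have "slash_head (h \<cdot> num n \<cdot> (tRec \<cdot> g \<cdot> h \<cdot> num n)) w"
      if "slash_head (tRec \<cdot> g \<cdot> h \<cdot> tSuc (num n)) w" for w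
      using that by (rule slash_head_appE) (auto simp: slash_head_rec2)
    moreover have "slash_head (tRec \<cdot> g \<cdot> h) (HRec2 g h)" "slash_val (tSuc (num n)) (Suc n)"
      by (simp_all add: slash_head_rec2)
    ultimately show ?case
      by (blast intro: slash_val_slash_head.slash_recS slash_val_slash_head.slash_hd_recS)
  next
    case (step_app t t' u)
    then show ?case
      using slash_app_cong[of t t'] by blast
  qed
  then show "slash_val c r \<longleftrightarrow> slash_val c' r" and "slash_head c w \<longleftrightarrow> slash_head c' w"
    by auto
qed

section \<open>Soundness of the calculus for slash evaluation\<close>

lemma head_step_ssub:
  assumes "c \<triangleright> c'" and "\<And>i. well_formed (\<sigma> i)"
  shows "ssub \<sigma> c \<triangleright> ssub \<sigma> c'"
  using assms(1)
proof induction
  case (step_beta t b)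
  then show ?case
    using head_step.step_beta[of "ssub \<sigma> t" "ssub (shift 1 \<sigma>) b"] assms(2)
    by (simp add: ssub_beta well_formed_ssub)
next
  case (step_rec0 h g)
  then show ?case
    using head_step.step_rec0[of "ssub \<sigma> h"] assms(2) by (simp add: well_formed_ssub)
next
  case (step_recS g h n)
  then show ?case
    using head_step.step_recS[of "ssub \<sigma> g"] assms(2) by (simp add: well_formed_ssub)
next
  case (step_app t t' u)
  then show ?case
    by (simp add: head_step.step_app)
qed

lemma head_step_well_formed: "c \<triangleright> c' \<Longrightarrow> well_formed c \<longleftrightarrow> well_formed c'"
  by (induction rule: head_step.induct) (auto simp: well_formed_beta)

text \<open>Contexts may contain ill-formed terms, which can have a value without anything being derivable
  about them. Therefore well-formedness is part of the truth of a hypothesis, so that true hypotheses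
  are derivable after substitution.\<close>

definition slashed :: "(nat \<Rightarrow> trm) \<Rightarrow> trm \<Rightarrow> bool" where
  "slashed \<sigma> a \<longleftrightarrow> well_formed a \<and> slash_val (ssub \<sigma> a) tt"

definition sound :: "sequent \<Rightarrow> bool" where
  "sound J \<longleftrightarrow> well_formed (snd J) \<and>
    (\<forall>\<sigma>. (\<forall>i. well_formed (\<sigma> i)) \<longrightarrow> (\<forall>a. a |\<in>| fst J \<longrightarrow> slashed \<sigma> a) \<longrightarrow> slashed \<sigma> (snd J))"

text \<open>The context with hole \<open>0\<close> that corresponds to \<open>p\<close> is obtained by lifting \<open>\<sigma>\<close> and sending \<open>i\<close> to
  the hole.\<close>

lemma slash_val_update:
  assumes "slash_val a n" and "slash_val b n" and "slash_val (ssub (\<sigma>(i := a)) p) r"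
    and "well_formed a" and "well_formed b" and "well_formed p" and "\<And>i. well_formed (\<sigma> i)"
  shows "slash_val (ssub (\<sigma>(i := b)) p) r"
proof -
  define q where "q = ssub (\<lambda>j. if j = i then Var 0 else \<up>(\<sigma> j)) p"
  have "beta q c = ssub (\<sigma>(i := c)) p" for c
    unfolding q_def beta_eq_ssub ssub_ssub by (rule ssub_cong) (simp add: ssub_case_nat_up)
  moreover have "well_formed q"
    using assms(6,7) by (simp add: q_def well_formed_ssub)
  ultimately show ?thesis
    using slash_replace_value[of a n b q r] assms by simp
qed

lemma slash_val_argument:
  assumes "slash_val a n" and "slash_val b n" and "slash_val (f \<cdot> a) r"
    and "well_formed a" and "well_formed b" and "well_formed f"
  shows "slash_val (f \<cdot> b) r"
  using slash_replace_value[of a n b "\<up>f \<cdot> Var 0" r] assms by (simp add: beta_up)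

text \<open>Replacement of equals, induction, the recursor and quantifier instances rest on interchanging a
  term with the numeral of its value; that everything follows from a contradiction rests on
  single-valuedness; for the two quantifier rules with a generic premise, the substitution is
  extended by a numeral.\<close>

lemma derivable_sound: "derivable J \<Longrightarrow> sound J"
proof (induction rule: derivable_induct)
  case (step S J)
  have wf: "well_formed c" if "(\<Gamma> \<turnstile> c) \<in> S" for \<Gamma> c
    using step(1)[OF that] by (simp add: sound_def)
  have truth: "slash_val (ssub \<sigma> c) tt"
    if "(\<Gamma> \<turnstile> c) \<in> S" "\<And>i. well_formed (\<sigma> i)" "\<And>a. a |\<in>| \<Gamma> \<Longrightarrow> slashed \<sigma> a" for \<Gamma> c \<sigma>
    using step(1)[OF that(1)] that(2,3) by (simp add: sound_def slashed_def)
  have "well_formed (snd J)"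
    using step(2)
  proof cases
    case (conv_expand c c' \<Gamma>)
    then show ?thesis using wf head_step_well_formed by auto
  next
    case (conv_reduce c c' \<Gamma>)
    then show ?thesis using wf head_step_well_formed by auto
  next
    case (conv_eq c c' \<Gamma>)
    then show ?thesis using wf head_step_well_formed by fastforce
  next
    case (substitution \<Gamma> c s v)
    then show ?thesis by (auto simp: subst_eq_ssub well_formed_ssub)
  next
    case (eq_subst \<Gamma> a b v p)
    then show ?thesis using wf[of \<Gamma> "a \<^bold>= b"] by (auto simp: subst_eq_ssub well_formed_ssub)
  next
    case (induction \<Gamma> i c a)
    then show ?thesis using wf[of \<Gamma> "isN a"] by (auto simp: subst_eq_ssub well_formed_ssub)
  qed (auto dest: wf)
  moreover have "slash_val (ssub \<sigma> (snd J)) tt"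
    if \<sigma>: "\<And>i. well_formed (\<sigma> i)" and ctx: "\<And>a. a |\<in>| fst J \<Longrightarrow> slashed \<sigma> a" for \<sigma>
  proof -
    note wf_\<sigma> = well_formed_ssub[of \<sigma>, OF \<sigma>]
    note truth_\<sigma> = truth[where \<sigma> = \<sigma>, OF _ \<sigma>]
    have premise: "slash_val (ssub \<sigma> (snd K)) tt" if "K \<in> S" and "fst K = fst J" for K
      using that ctx truth_\<sigma>[of "fst K" "snd K"] by (metis prod.collapse)
    have unique: False if "slash_val t 0" "slash_val t 1" for t
      using slash_val_unique[OF that] by simp
    have sub: "well_formed (case_nat u \<sigma> i)" if "well_formed u" for u i
      using that \<sigma> by (simp split: nat.split)
    show ?thesis
      using step(2)
    proof cases
      case (weaken \<Gamma> c a)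
      then show ?thesis using truth_\<sigma> ctx by auto
    next
      case (hyp c \<Gamma>)
      then show ?thesis using ctx by (auto simp: slashed_def)
    next
      case (cut \<Gamma> a c)
      then have "slashed \<sigma> a"
        using truth_\<sigma> ctx wf by (auto simp: slashed_def)
      then show ?thesis using cut truth_\<sigma> ctx by auto
    next
      case (substitution \<Gamma> c s v)
      have "slashed (\<sigma>(v := ssub \<sigma> s)) a" if "a |\<in>| \<Gamma>" for a
        using that substitution ctx[of "subst v s a"] by (auto simp: slashed_def ssub_subst)
      then show ?thesis
        using substitution truth[of \<Gamma> c "\<sigma>(v := ssub \<sigma> s)"] \<sigma> by (auto simp: ssub_subst wf_\<sigma>)
    next
      case (not_E \<Gamma> a c)
      then have "slash_val (ssub \<sigma> a) 0" "slash_val (ssub \<sigma> a) 1"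
        using truth_\<sigma>[of \<Gamma>] ctx by fastforce+
      then show ?thesis using unique by blast
    next
      case (or_E \<Gamma> a b c)
      have "well_formed (a \<^bold>\<or> b)" "slash_val (ssub \<sigma> (a \<^bold>\<or> b)) tt"
        using truth_\<sigma>[OF or_E(2)] wf[OF or_E(2)] or_E(1) ctx by auto
      then have "slashed \<sigma> a \<or> slashed \<sigma> b"
        by (auto simp: slashed_def)
      then show ?thesis using or_E truth_\<sigma> ctx by auto
    next
      case (eq_subst \<Gamma> a b v p)
      then obtain n where "slash_val (ssub \<sigma> a) n" "slash_val (ssub \<sigma> b) n"
        using truth_\<sigma>[OF eq_subst(2)] ctx by (auto split: if_splits)
      moreover have "well_formed a" "well_formed b"
        using wf[OF eq_subst(2)] by auto
      moreover have "slash_val (ssub (\<sigma>(v := ssub \<sigma> a)) p) tt"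
        using truth_\<sigma>[OF eq_subst(3)] eq_subst ctx by (auto simp: ssub_subst)
      ultimately show ?thesis
        using slash_val_update[of "ssub \<sigma> a" n "ssub \<sigma> b" \<sigma> v p tt] eq_subst \<sigma>
        by (simp add: ssub_subst wf_\<sigma>)
    next
      case (induction \<Gamma> i c a)
      then obtain n where n: "slash_val (ssub \<sigma> a) n"
        using truth_\<sigma>[OF induction(4)] ctx by auto
      \<comment> \<open>The premises of the rule reach every numeral, and the value of \<open>a\<close> is one of them.\<close>
      have "slash_val (ssub (\<sigma>(i := num k)) c) tt" for k
      proof (induction k)
        case 0
        have "slash_val (ssub (\<sigma>(i := tZero)) c) tt"
          using truth_\<sigma>[OF induction(2)] induction(1) ctx by (simp add: ssub_subst)
        then show ?case
          by (simp only: num.simps)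
      next
        case (Suc k)
        have "slashed (\<sigma>(i := num k)) b" if "b |\<in>| \<Gamma>" for b
        proof -
          have "ssub (\<sigma>(i := num k)) b = ssub \<sigma> b"
            using induction(6) that by (intro ssub_cong) auto
          then show ?thesis
            using ctx[of b] induction(1) that by (simp add: slashed_def)
        qed
        moreover have "slashed (\<sigma>(i := num k)) c" "slashed (\<sigma>(i := num k)) (isN (Var i))"
          using Suc induction(5) by (auto simp: slashed_def fun_upd_def)
        ultimately have "slash_val (ssub (\<sigma>(i := num k)) (subst i (tSuc (Var i)) c)) tt"
          using \<sigma> by (intro truth[OF induction(3)]) auto
        then have "slash_val (ssub (\<sigma>(i := num (Suc k))) c) tt"
          by (simp add: ssub_subst)
        then show ?case
          by (simp add: fun_upd_def)
      qed
      then show ?thesis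
        using slash_val_update[OF slash_val_num n, of \<sigma> i c tt] induction wf[OF induction(4)] \<sigma>
        by (auto simp: ssub_subst wf_\<sigma>)
    next
      case (conv_expand c c' \<Gamma>)
      then show ?thesis
        using slash_head_step(1)[OF head_step_ssub[of c c' \<sigma>, OF _ \<sigma>]] truth_\<sigma> ctx by auto
    next
      case (conv_reduce c c' \<Gamma>)
      then show ?thesis
        using slash_head_step(1)[OF head_step_ssub[of c c' \<sigma>, OF _ \<sigma>]] truth_\<sigma> ctx by auto
    next
      case (conv_eq c c' \<Gamma>)
      then obtain n where "slash_val (ssub \<sigma> c') n"
        using truth_\<sigma>[OF conv_eq(3)] ctx by auto
      then show ?thesis
        using conv_eq slash_head_step(1)[OF head_step_ssub[of c c' \<sigma>, OF _ \<sigma>]] by auto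
    next
      case (rec_suc \<Gamma> m h g)
      then obtain k where k: "slash_val (ssub \<sigma> m) k"
        using truth_\<sigma>[OF rec_suc(2)] ctx by auto
      obtain r where r: "slash_val (ssub \<sigma> (h \<cdot> m \<cdot> (tRec \<cdot> g \<cdot> h \<cdot> m))) r"
        using truth_\<sigma>[OF rec_suc(3)] ctx rec_suc(1) by auto
      have "well_formed m" "well_formed h" 
        using wf[OF rec_suc(3)] by auto
      then have "slash_val (ssub \<sigma> (h \<cdot> num k \<cdot> (tRec \<cdot> g \<cdot> h \<cdot> num k))) r"
        using slash_replace_value[OF k slash_val_num,
            of "\<up>(ssub \<sigma> h) \<cdot> Var 0 \<cdot> (tRec \<cdot> \<up>(ssub \<sigma> g) \<cdot> \<up>(ssub \<sigma> h) \<cdot> Var 0)" r] r rec_suc(4)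
        by (simp add: beta_up wf_\<sigma>)
      then have "slash_val (ssub \<sigma> (tRec \<cdot> g \<cdot> h \<cdot> tSuc m)) r"
        using k by (auto intro!: slash_recS[of _ "ssub \<sigma> g" "ssub \<sigma> h" _ k] simp: slash_head_rec2)
      then show ?thesis
        using r rec_suc(1) by auto
    next
      case (all_I \<Gamma> f)
      \<comment> \<open>Derivability comes from the conclusion of the rule itself, not from its premise, so the
        eigenvariable does not interfere.\<close>
      have "derivable ({||} \<turnstile> ssub \<sigma> (tAll \<cdot> f))"
      proof (rule derivable_cut_all)
        have "well_formed f"
          using wf[OF all_I(2)] by simp
        moreover have "wf_ctx \<Gamma>"
          using ctx all_I(1) by (simp add: slashed_def)
        ultimately show "derivable (ssub \<sigma> |`| \<Gamma> \<turnstile> ssub \<sigma> (tAll \<cdot> f))"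
          using step(3) all_I(1) \<sigma> by (intro derivable_ssub) auto
        show "derivable ({||} \<turnstile> a)" if a: "a |\<in>| ssub \<sigma> |`| \<Gamma>" for a
        proof -
          obtain b where "b |\<in>| \<Gamma>" "a = ssub \<sigma> b"
            using a by auto
          then have "well_formed a" "slash_val a tt"
            using ctx all_I(1) by (auto simp: slashed_def wf_\<sigma>)
          then show ?thesis
            using slash_derivable[of a tt] derivable_true_E by simp
        qed
      qed
      moreover have "slash_val (ssub \<sigma> (f \<cdot> num i)) tt" for i
      proof -
        have "slash_val (ssub (case_nat (num i) \<sigma>) (\<up>f \<cdot> Var 0)) tt"
          using ctx all_I(1) by (intro truth[OF all_I(2)])
            (auto simp: slashed_def ssub_case_nat_up sub)
        then show ?thesis
          by (simp add: ssub_case_nat_up)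
      qed
      ultimately show ?thesis
        using all_I(1) by (auto intro: slash_all_tt)
    next
      case (all_E \<Gamma> f a)
      have "slash_val (tAll \<cdot> ssub \<sigma> f) tt"
        using truth_\<sigma>[OF all_E(2)] ctx all_E(1) by simp
      then have f: "slash_val (ssub \<sigma> f \<cdot> num i) tt" for i
        by (rule slash_val_appE) auto
      obtain n where n: "slash_val (ssub \<sigma> a) n"
        using truth_\<sigma>[OF all_E(3)] ctx all_E(1) by auto
      have "well_formed f" "well_formed a"
        using wf[OF all_E(2)] wf[OF all_E(3)] by auto
      then show ?thesis
        using slash_val_argument[OF slash_val_num n f] all_E(1) by (simp add: wf_\<sigma>)
    next
      case (not_all_I \<Gamma> f a)
      have f: "slash_val (ssub \<sigma> f \<cdot> ssub \<sigma> a) ff"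
        using truth_\<sigma>[OF not_all_I(2)] ctx not_all_I(1) by simp
      obtain n where n: "slash_val (ssub \<sigma> a) n"
        using truth_\<sigma>[OF not_all_I(3)] ctx not_all_I(1) by auto
      have "well_formed f" "well_formed a"
        using wf[OF not_all_I(2)] by auto
      then have "slash_val (ssub \<sigma> f \<cdot> num n) ff"
        using slash_val_argument[OF n slash_val_num f] by (simp add: wf_\<sigma>)
      then have "slash_val (tAll \<cdot> ssub \<sigma> f) ff"
        by (rule slash_all_ff[OF slash_hd_all])
      then show ?thesis
        using not_all_I(1) by simp
    next
      case (not_all_E \<Gamma> f c)
      have "slash_val (tAll \<cdot> ssub \<sigma> f) ff"
        using truth_\<sigma>[OF not_all_E(2)] ctx not_all_E(1) by simp
      then obtain i where i: "slash_val (ssub \<sigma> f \<cdot> num i) ff"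
        by (rule slash_val_appE) auto
      have "well_formed f"
        using wf[OF not_all_E(2)] by auto
      then have "slash_val (ssub (case_nat (num i) \<sigma>) (\<up>c)) tt"
        using ctx not_all_E(1) i by (intro truth[OF not_all_E(3)])
          (auto simp: slashed_def ssub_case_nat_up sub)
      then show ?thesis
        using not_all_E(1) by (simp add: ssub_case_nat_up)
    next
      case (bot_E \<Gamma> p)
      then show ?thesis using truth_\<sigma>[OF bot_E(2)] ctx by simp
    qed (((drule premise, simp flip: One_nat_def)+)?,
        fastforce simp flip: One_nat_def)+
  qed
  ultimately show ?case
    by (auto simp: sound_def slashed_def)
qed

theorem theorem4p5:
  fixes code :: "derivation \<Rightarrow> nat" and c :: trm
  assumes "inj code" and "well_formed c"
  shows "(derivable ({||} \<turnstile> c) \<longleftrightarrow> (\<exists>s. code \<tturnstile> c \<Down>\<^bsub>s\<^esub> tt)) \<and>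
    (\<forall>r. derivable ({||} \<turnstile> c \<^bold>= num r) \<longleftrightarrow> (\<exists>s. code \<tturnstile> c \<Down>\<^bsub>s\<^esub> r))"
proof -
  have sound: "slash_val t tt" if "derivable ({||} \<turnstile> t)" for t
    using derivable_sound[OF that] unfolding sound_def slashed_def
    by (auto dest!: spec[of _ Var])
  have complete: "derivable ({||} \<turnstile> c \<^bold>= num r)" if "code \<tturnstile> c \<Down>\<^bsub>s\<^esub> r" for s r
    using eval_derivable(1)[OF that assms(2)] .
  have "\<exists>s. code \<tturnstile> c \<Down>\<^bsub>s\<^esub> tt" if "derivable ({||} \<turnstile> c)"
    using slash_eval(1)[OF sound[OF that] assms(2)] .
  moreover have "derivable ({||} \<turnstile> c)" if "code \<tturnstile> c \<Down>\<^bsub>s\<^esub> tt" for s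
    using complete[OF that] derivable_true_E by simp
  moreover have "\<exists>s. code \<tturnstile> c \<Down>\<^bsub>s\<^esub> r" if der: "derivable ({||} \<turnstile> c \<^bold>= num r)" for r
  proof -
    obtain n where "slash_val c n" "slash_val (num r) n"
      using sound[OF der] by (auto split: if_splits)
    then have "slash_val c r"
      using slash_val_unique slash_val_num by metis
    then show ?thesis
      using slash_eval(1) assms(2) by blast
  qed
  ultimately show ?thesis
    using complete by blast
qed

end
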